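(* Let $(X, G)$ be an expansive action of a sofic group with $M (X, G)\neq \emptyset$. Then $h_{\bullet,\Sigma}(X,G): M(X, G)\rightarrow [0,\infty)\cup \{-\infty\}$, $\mu\mapsto h_{\mu,\Sigma}(X,G)$, is an upper semi-continuous function.
   Context: Setting: $G$ is a countable discrete sofic group with a fixed sofic approximation $\Sigma=\{\sigma_i: G \rightarrow \mathrm{Sym}(d_i),\ g\mapsto \sigma_{i, g}\}_{i\in \mathbb{N}}$, where $d_i\in\mathbb{N}$, $d_i\to\infty$, $\mathrm{Sym}(d)$ is the permutation group of $\{1,\dots,d\}$, and $\lim_{i} \frac{1}{d_i} |\{a: \sigma_{i,s}\sigma_{i,t}(a)=\sigma_{i,st}(a)\}|=1$ for all $s,t\in G$, $\lim_{i} \frac{1}{d_i} |\{a: \sigma_{i,s}(a)\neq \sigma_{i,t}(a)\}|=1$ for all distinct $s,t\in G$. $G$ acts continuously on a compact metric space $(X,\rho)$. $(X,G)$ is expansive if there is $\delta>0$ (an expansive constant) such that for any two different points $x_1,x_2\in X$ there is $g\in G$ with $\rho(gx_1,gx_2)>\delta$. $M(X)$ is the set of Borel probability measures on $X$ with the weak star topology (a compact metric space), $M(X,G)\subset M(X)$ the subset of $G$-invariant measures. $\mathcal{B}_X$ is the Borel $\sigma$-algebra. A function $f:Y\to[-\infty,\infty)$ on a compact metric space $Y$ is upper semi-continuous if $\limsup_{y'\to y}f(y')\le f(y)$ for each $y\in Y$. Convention: $\log 0=-\infty$. $\mathfrak{F}_G$ is the set of non-empty finite subsets of $G$. Entropy: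 let $\mu\in M(X,G)$ and let $\alpha=\{A_1,\dots,A_k\}$ be a finite Borel partition of $X$. For $\sigma:G\to\mathrm{Sym}(d)$, let $\zeta$ be the uniform probability measure on $\{1,\dots,d\}$, and let $\beta=\{B_1,\dots,B_k\}$ be a partition of $\{1,\dots,d\}$ (indexed by $1,\dots,k$, blocks may be empty). For $F\in\mathfrak{F}_G$ let $\mathrm{Map}(F,k)$ be the set of functions $\phi:F\to\{1,\dots,k\}$, and $d_F(\alpha,\beta)=\sum_{\phi\in\mathrm{Map}(F,k)}|\mu(A_\phi)-\zeta(B_\phi)|$, where $A_\phi=\bigcap_{f\in F}f^{-1}A_{\phi(f)}$ and $B_\phi=\bigcap_{f\in F}\sigma(f)^{-1}B_{\phi(f)}$. For $\varepsilon>0$ let $AP_\mu(\sigma,\alpha:F,\varepsilon)$ be the set of all such partitions $\beta$ with $d_F(\alpha,\beta)\le\varepsilon$. Define $$H_{\mu,\Sigma}(\alpha:F,\varepsilon)=\limsup_{i\to\infty}\frac{1}{d_i}\log|AP_\mu(\sigma_i,\alpha:F,\varepsilon)|,\quad H_{\mu,\Sigma}(\alpha:F)=\inf_{\varepsilon>0}H_{\mu,\Sigma}(\alpha:F,\varepsilon),\quad h_{\mu,\Sigma}(\alpha)=\inf_{F\in\mathfrak{F}_G}H_{\mu,\Sigma}(\alpha:F).$$ The partition $\alpha$ generates $\mathcal{B}_X$ (in the sense of $\mu$) if for each $B\in\mathcal{B}_X$ there is $A\in\mathcal{A}$ with $\mu(A\Delta B)=0$, where $\mathcal{A}$ is the smallest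 $G$-invariant sub-$\sigma$-algebra of $\mathcal{B}_X$ containing $\alpha$. By a theorem of L. Bowen, $h_{\mu,\Sigma}(\alpha)$ takes the same value for all generating finite Borel partitions $\alpha$; when such a partition exists, this common value is denoted $h_{\mu,\Sigma}(X,G)$. For an expansive action with expansive constant $\delta$, every finite Borel partition whose elements all have diameter less than $\delta$ generates $\mathcal{B}_X$ for every $\mu\in M(X,G)$, so $h_{\mu,\Sigma}(X,G)$ is well defined for every $\mu\in M(X,G)$. *)

theory Defs
  imports "HOL-Probability.Probability_Measure" "HOL-Algebra.Group_Action"
begin

section \<open>Sofic approximations\<close>

text \<open>The condition on \<^term>\<open>d\<close> makes \<^term>\<open>d i\<close> positive for all but finitely many
  indices; the remaining ones affect none of the limits below.\<close>

definition sofic_approximation ::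
    "('g, 'm) monoid_scheme \<Rightarrow> (nat \<Rightarrow> nat) \<Rightarrow> (nat \<Rightarrow> 'g \<Rightarrow> nat \<Rightarrow> nat) \<Rightarrow> bool" where
  "sofic_approximation G d \<sigma> \<longleftrightarrow>
     filterlim d at_top sequentially \<and>
     (\<forall>i. \<forall>g\<in>carrier G. \<sigma> i g permutes {1..d i}) \<and>
     (\<forall>s\<in>carrier G. \<forall>t\<in>carrier G.
        (\<lambda>i. 1 / real (d i) *
             real (card {a\<in>{1..d i}. \<sigma> i s (\<sigma> i t a) = \<sigma> i (s \<otimes>\<^bsub>G\<^esub> t) a})) \<longlonglongrightarrow> 1) \<and>
     (\<forall>s\<in>carrier G. \<forall>t\<in>carrier G. s \<noteq> t \<longrightarrow>
        (\<lambda>i. 1 / real (d i) * real (card {a\<in>{1..d i}. \<sigma> i s a \<noteq> \<sigma> i t a})) \<longlonglongrightarrow> 1)"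

section \<open>Expansive actions and the space of measures\<close>

definition continuous_action ::
    "('g, 'm) monoid_scheme \<Rightarrow> ('g \<Rightarrow> 'x::topological_space \<Rightarrow> 'x) \<Rightarrow> bool" where
  "continuous_action G act \<longleftrightarrow>
     group_action G UNIV act \<and> (\<forall>g\<in>carrier G. continuous_on UNIV (act g))"

definition expansive ::
    "('g, 'm) monoid_scheme \<Rightarrow> ('g \<Rightarrow> 'x::metric_space \<Rightarrow> 'x) \<Rightarrow> bool" where
  "expansive G act \<longleftrightarrow>
     (\<exists>\<delta>>0. \<forall>x y. x \<noteq> y \<longrightarrow> (\<exists>g\<in>carrier G. dist (act g x) (act g y) > \<delta>))"

definition borel_prob_measures :: "'x::topological_space measure set" where
  "borel_prob_measures = {\<mu>. prob_space \<mu> \<and> sets \<mu> = sets borel}"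

definition invariant_measures ::
    "('g, 'm) monoid_scheme \<Rightarrow> ('g \<Rightarrow> 'x::topological_space \<Rightarrow> 'x) \<Rightarrow> 'x measure set" where
  "invariant_measures G act =
     {\<mu> \<in> borel_prob_measures. \<forall>g\<in>carrier G. distr \<mu> borel (act g) = \<mu>}"

text \<open>The coarsest topology making \<open>\<mu> \<mapsto> \<integral> f d\<mu>\<close> continuous for every real continuous \<open>f\<close>.
  It is the weak star topology when the underlying space is compact, the only case used here.\<close>

definition weak_star_topology :: "'x::topological_space measure topology" where
  "weak_star_topology = topology_generated_by
     {{\<mu> \<in> borel_prob_measures. (\<integral>x. f x \<partial>\<mu>) \<in> U} | (f :: 'x \<Rightarrow> real) U.
        continuous_on UNIV f \<and> open U}"

lemma topspace_weak_star_topology: "topspace weak_star_topology = borel_prob_measures"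
proof -
  have "\<exists>f U. {\<mu> \<in> borel_prob_measures. (\<integral>x. f x \<partial>\<mu>) \<in> U} = borel_prob_measures \<and>
          continuous_on UNIV (f :: 'a \<Rightarrow> real) \<and> open U"
    by (rule exI[of _ "\<lambda>_. 0"], rule exI[of _ UNIV]) auto
  then show ?thesis
    unfolding weak_star_topology_def topology_generated_by_topspace by blast
qed

text \<open>\<^term>\<open>atin T y\<close> is the filter of punctured neighbourhoods; including \<^term>\<open>y\<close> itself
  would give the same condition.\<close>

definition upper_semicontinuous_map :: "'a topology \<Rightarrow> ('a \<Rightarrow> ereal) \<Rightarrow> bool" where
  "upper_semicontinuous_map T f \<longleftrightarrow>
     (\<forall>y\<in>topspace T. f y \<noteq> \<infinity> \<and> Limsup (atin T y) f \<le> f y)"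

section \<open>Sofic measure entropy\<close>

text \<open>Partitions are families indexed by \<^term>\<open>{1..k}\<close>; empty blocks are allowed.\<close>

definition borel_partition :: "nat \<Rightarrow> (nat \<Rightarrow> 'x::topological_space set) \<Rightarrow> bool" where
  "borel_partition k A \<longleftrightarrow>
     (\<forall>j\<in>{1..k}. A j \<in> sets borel) \<and> disjoint_family_on A {1..k} \<and> (\<Union>j\<in>{1..k}. A j) = UNIV"

text \<open>The families below are extensional outside \<^term>\<open>{1..k}\<close>, so that the cardinality of
  this set is the number of indexed partitions.\<close>

definition indexed_partitions :: "nat \<Rightarrow> nat \<Rightarrow> (nat \<Rightarrow> nat set) set" where
  "indexed_partitions k n =
     {B \<in> {1..k} \<rightarrow>\<^sub>E Pow {1..n}. disjoint_family_on B {1..k} \<and> (\<Union>j\<in>{1..k}. B j) = {1..n}}"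

definition partition_dist ::
    "('g \<Rightarrow> 'x \<Rightarrow> 'x) \<Rightarrow> 'x measure \<Rightarrow> nat \<Rightarrow> ('g \<Rightarrow> nat \<Rightarrow> nat) \<Rightarrow> nat \<Rightarrow>
      (nat \<Rightarrow> 'x set) \<Rightarrow> 'g set \<Rightarrow> (nat \<Rightarrow> nat set) \<Rightarrow> real" where
  "partition_dist act \<mu> n s k A F B =
     (\<Sum>\<phi>\<in>F \<rightarrow>\<^sub>E {1..k}.
        \<bar>measure \<mu> (\<Inter>f\<in>F. act f -` A (\<phi> f)) -
         measure (uniform_count_measure {1..n}) (\<Inter>f\<in>F. s f -` B (\<phi> f))\<bar>)"

definition AP ::
    "('g \<Rightarrow> 'x \<Rightarrow> 'x) \<Rightarrow> 'x measure \<Rightarrow> nat \<Rightarrow> ('g \<Rightarrow> nat \<Rightarrow> nat) \<Rightarrow> nat \<Rightarrow>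
      (nat \<Rightarrow> 'x set) \<Rightarrow> 'g set \<Rightarrow> real \<Rightarrow> (nat \<Rightarrow> nat set) set" where
  "AP act \<mu> n s k A F \<epsilon> =
     {B \<in> indexed_partitions k n. partition_dist act \<mu> n s k A F B \<le> \<epsilon>}"

definition log_card :: "'a set \<Rightarrow> ereal" where
  "log_card S = (if card S = 0 then - \<infinity> else ereal (ln (real (card S))))"

definition entropy_at ::
    "('g \<Rightarrow> 'x \<Rightarrow> 'x) \<Rightarrow> (nat \<Rightarrow> nat) \<Rightarrow> (nat \<Rightarrow> 'g \<Rightarrow> nat \<Rightarrow> nat) \<Rightarrow> 'x measure \<Rightarrow> nat \<Rightarrow>
      (nat \<Rightarrow> 'x set) \<Rightarrow> 'g set \<Rightarrow> real \<Rightarrow> ereal" where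
  "entropy_at act d \<sigma> \<mu> k A F \<epsilon> =
     limsup (\<lambda>i. ereal (1 / real (d i)) * log_card (AP act \<mu> (d i) (\<sigma> i) k A F \<epsilon>))"

definition partition_entropy ::
    "('g, 'm) monoid_scheme \<Rightarrow> ('g \<Rightarrow> 'x \<Rightarrow> 'x) \<Rightarrow> (nat \<Rightarrow> nat) \<Rightarrow>
      (nat \<Rightarrow> 'g \<Rightarrow> nat \<Rightarrow> nat) \<Rightarrow> 'x measure \<Rightarrow> nat \<Rightarrow> (nat \<Rightarrow> 'x set) \<Rightarrow> ereal" where
  "partition_entropy G act d \<sigma> \<mu> k A =
     (INF F\<in>{F. finite F \<and> F \<noteq> {} \<and> F \<subseteq> carrier G}.
        INF \<epsilon>\<in>{0<..}. entropy_at act d \<sigma> \<mu> k A F \<epsilon>)"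

text \<open>The smallest invariant sub-\<open>\<sigma>\<close>-algebra of the Borel sets containing the blocks.\<close>

definition invariant_sigma_algebra ::
    "('g, 'm) monoid_scheme \<Rightarrow> ('g \<Rightarrow> 'x::topological_space \<Rightarrow> 'x) \<Rightarrow> nat \<Rightarrow>
      (nat \<Rightarrow> 'x set) \<Rightarrow> 'x set set" where
  "invariant_sigma_algebra G act k A =
     \<Inter>{S. sigma_algebra UNIV S \<and> S \<subseteq> sets borel \<and>
          (\<forall>g\<in>carrier G. \<forall>C\<in>S. act g ` C \<in> S) \<and> A ` {1..k} \<subseteq> S}"

definition generating ::
    "('g, 'm) monoid_scheme \<Rightarrow> ('g \<Rightarrow> 'x::topological_space \<Rightarrow> 'x) \<Rightarrow> 'x measure \<Rightarrow> nat \<Rightarrow>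
      (nat \<Rightarrow> 'x set) \<Rightarrow> bool" where
  "generating G act \<mu> k A \<longleftrightarrow>
     (\<forall>B\<in>sets borel. \<exists>C\<in>invariant_sigma_algebra G act k A.
        measure \<mu> ((C - B) \<union> (B - C)) = 0)"

text \<open>The common value over all generating finite Borel partitions. It is well defined when such
  a partition exists, by Bowen's theorem.\<close>

definition sofic_entropy ::
    "('g, 'm) monoid_scheme \<Rightarrow> ('g \<Rightarrow> 'x::topological_space \<Rightarrow> 'x) \<Rightarrow> (nat \<Rightarrow> nat) \<Rightarrow>
      (nat \<Rightarrow> 'g \<Rightarrow> nat \<Rightarrow> nat) \<Rightarrow> 'x measure \<Rightarrow> ereal" where
  "sofic_entropy G act d \<sigma> \<mu> =
     (THE h. \<forall>k A. borel_partition k A \<and> generating G act \<mu> k A \<longrightarrow>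
        partition_entropy G act d \<sigma> \<mu> k A = h)"

end

theory Submission
  imports Defs
begin

text \<open>
  Bowen's theorem is proved by coding. If \<open>\<alpha>\<close> and \<open>\<beta>\<close> both generate, then \<open>\<beta>\<close> is close to a
  function \<open>\<Phi>\<close> of finitely many translates of \<open>\<alpha>\<close>, and \<open>\<alpha>\<close> to a function \<open>\<Psi>\<close> of finitely many
  translates of \<open>\<beta>\<close>. Applying \<open>\<Phi>\<close> along the sofic approximation turns a labelling \<open>a\<close> of
  \<open>{1..d i}\<close> with almost the statistics of \<open>\<alpha>\<close> into a labelling \<open>b\<close> with almost the statistics of
  \<open>\<beta>\<close>, and \<open>\<Psi>\<close> applied to \<open>b\<close> returns \<open>a\<close> up to a small proportion of errors. So the fibres of
  \<open>a \<mapsto> b\<close> lie in small Hamming balls, whose cardinality is at most \<open>exp (r * d i)\<close> with \<open>r\<close>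
  arbitrarily small.

  Given an invariant \<open>\<mu>\<close>, there is a partition into sets of small diameter with \<open>\<mu>\<close>-null boundaries.
  By expansiveness it generates for every invariant measure, so it computes all entropies. The
  measures of the sets entering a given \<^const>\<open>partition_dist\<close> are continuous at \<open>\<mu>\<close>, hence
  the approximate partitions for \<open>\<nu>\<close> near \<open>\<mu>\<close> are also approximate for \<open>\<mu>\<close>.
\<close>

section \<open>Laws of finitely valued functions\<close>

definition law :: "'a measure \<Rightarrow> ('a \<Rightarrow> 'c) \<Rightarrow> 'c \<Rightarrow> real" where
  "law M P c = measure M {x\<in>space M. P x = c}"

text \<open>The \<ell>1 distance of two distributions on \<open>S\<close>. The two functions may
  live on different spaces, so that statistics on the dynamical system can be compared with
  statistics on a finite model.\<close>

definition law_dist :: "'c set \<Rightarrow> 'a measure \<Rightarrow> ('a \<Rightarrow> 'c) \<Rightarrow> 'b measure \<Rightarrow> ('b \<Rightarrow> 'c) \<Rightarrow> real" where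
  "law_dist S M P N Q = (\<Sum>c\<in>S. \<bar>law M P c - law N Q c\<bar>)"

lemma law_dist_triangle:
  "law_dist S M P N Q \<le> law_dist S M P M' P' + law_dist S M' P' N Q"
  unfolding law_dist_def sum.distrib[symmetric] by (intro sum_mono) linarith

lemma measure_eq_sum_law:
  assumes "finite_measure M" "P \<in> measurable M (count_space S)" "finite S" "T \<subseteq> S"
  shows "measure M {x\<in>space M. P x \<in> T} = (\<Sum>c\<in>T. law M P c)"
proof -
  interpret finite_measure M by fact
  have "{x\<in>space M. P x = c} \<in> sets M" if "c \<in> S" for c
    using measurable_sets[OF assms(2), of "{c}"] that by (simp add: vimage_def Int_def conj_commute)
  then have "measure M (\<Union>c\<in>T. {x\<in>space M. P x = c}) = (\<Sum>c\<in>T. law M P c)"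
    unfolding law_def using assms
    by (intro finite_measure_finite_Union) (auto simp: disjoint_family_on_def intro: finite_subset)
  also have "(\<Union>c\<in>T. {x\<in>space M. P x = c}) = {x\<in>space M. P x \<in> T}"
    by auto
  finally show ?thesis .
qed

text \<open>Carries the probability of a set of values from one space to another; later the event
  that a decoding fails is moved from \<open>\<mu>\<close> to the finite model in this way.\<close>

lemma measure_diff_le_law_dist:
  assumes "finite_measure M" "P \<in> measurable M (count_space S)"
    and "finite_measure N" "Q \<in> measurable N (count_space S)" and "finite S" "T \<subseteq> S"
  shows "\<bar>measure M {x\<in>space M. P x \<in> T} - measure N {x\<in>space N. Q x \<in> T}\<bar> \<le> law_dist S M P N Q"
proof -
  have "\<bar>\<Sum>c\<in>T. law M P c - law N Q c\<bar> \<le> (\<Sum>c\<in>T. \<bar>law M P c - law N Q c\<bar>)"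
    by (rule sum_abs)
  also have "\<dots> \<le> law_dist S M P N Q"
    unfolding law_dist_def using assms by (intro sum_mono2) auto
  finally show ?thesis
    using assms by (simp add: measure_eq_sum_law sum_subtractf)
qed

text \<open>Applying \<open>h\<close> merges the atoms of each fibre, and the absolute value of a
  sum of differences is at most the sum of their absolute values. Grouping \<open>S\<close> by the
  fibres of \<open>h\<close> gives the bound.\<close>

lemma law_dist_comp_le:
  assumes "finite_measure M" "P \<in> measurable M (count_space S)"
    and "finite_measure N" "Q \<in> measurable N (count_space S)"
    and "finite S" "finite S'" "h \<in> S \<rightarrow> S'"
  shows "law_dist S' M (\<lambda>x. h (P x)) N (\<lambda>x. h (Q x)) \<le> law_dist S M P N Q"
proof -
  have PS: "P x \<in> S" if "x \<in> space M" for x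
    using measurable_space[OF assms(2) that] by simp
  have QS: "Q x \<in> S" if "x \<in> space N" for x
    using measurable_space[OF assms(4) that] by simp
  have P: "law M (\<lambda>x. h (P x)) c = (\<Sum>b\<in>{b\<in>S. h b = c}. law M P b)" for c
    using assms PS by (subst measure_eq_sum_law[symmetric, where S=S])
      (auto simp: law_def intro!: arg_cong[where f="measure M"])
  have Q: "law N (\<lambda>x. h (Q x)) c = (\<Sum>b\<in>{b\<in>S. h b = c}. law N Q b)" for c
    using assms QS by (subst measure_eq_sum_law[symmetric, where S=S])
      (auto simp: law_def intro!: arg_cong[where f="measure N"])
  have "law_dist S' M (\<lambda>x. h (P x)) N (\<lambda>x. h (Q x))
      \<le> (\<Sum>c\<in>S'. \<Sum>b\<in>{b\<in>S. h b = c}. \<bar>law M P b - law N Q b\<bar>)"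
    unfolding law_dist_def P Q sum_subtractf[symmetric] by (intro sum_mono sum_abs)
  also have "\<dots> = law_dist S M P N Q"
    unfolding law_dist_def using assms by (intro sum.group) auto
  finally show ?thesis .
qed

text \<open>The coupling inequality. Off the set \<open>D\<close> of disagreement both functions
  take the same value, so the weights of \<open>c\<close> differ by at most the mass of
  \<open>c\<close> inside \<open>D\<close> under \<open>P\<close> plus that under \<open>Q\<close>.
  Summing over \<open>c\<close> counts \<open>D\<close> twice.\<close>

lemma law_dist_le_disagreement:
  assumes "finite_measure M" "P \<in> measurable M (count_space S)" "Q \<in> measurable M (count_space S)"
    and "finite S"
  shows "law_dist S M P M Q \<le> 2 * measure M {x\<in>space M. P x \<noteq> Q x}"
proof -
  interpret finite_measure M by fact
  have Ps: "{x\<in>space M. P x = c} \<in> sets M" if "c \<in> S" for c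
    using measurable_sets[OF assms(2), of "{c}"] that by (simp add: vimage_def Int_def conj_commute)
  have Qs: "{x\<in>space M. Q x = c} \<in> sets M" if "c \<in> S" for c
    using measurable_sets[OF assms(3), of "{c}"] that by (simp add: vimage_def Int_def conj_commute)
  define D where "D = {x\<in>space M. P x \<noteq> Q x}"
  have PS: "P x \<in> S" if "x \<in> space M" for x
    using measurable_space[OF assms(2) that] by simp
  have QS: "Q x \<in> S" if "x \<in> space M" for x
    using measurable_space[OF assms(3) that] by simp
  have "D = (\<Union>c\<in>S. {x\<in>space M. P x = c} - {x\<in>space M. Q x = c})"
    unfolding D_def using PS by auto
  then have D: "D \<in> sets M"
    using Ps Qs \<open>finite S\<close> by auto
  define p where "p c = measure M (D \<inter> {x\<in>space M. P x = c})" for c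
  define q where "q c = measure M (D \<inter> {x\<in>space M. Q x = c})" for c
  have sp: "(\<Sum>c\<in>S. p c) = measure M D"
    unfolding p_def using D Ps PS \<open>finite S\<close>
    by (subst finite_measure_finite_Union[symmetric])
      (auto simp: disjoint_family_on_def D_def intro!: arg_cong[where f="measure M"])
  have sq: "(\<Sum>c\<in>S. q c) = measure M D"
    unfolding q_def using D Qs QS \<open>finite S\<close>
    by (subst finite_measure_finite_Union[symmetric])
      (auto simp: disjoint_family_on_def D_def intro!: arg_cong[where f="measure M"])
  have "\<bar>law M P c - law M Q c\<bar> \<le> p c + q c" if "c \<in> S" for c
  proof -
    have "law M P c \<le> measure M ({x\<in>space M. Q x = c} \<union> (D \<inter> {x\<in>space M. P x = c}))"
      unfolding law_def using Ps Qs D that by (intro finite_measure_mono) (auto simp: D_def)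
    also have "\<dots> \<le> law M Q c + p c"
      unfolding law_def p_def using Ps Qs D that by (intro measure_Un_le) auto
    finally have 1: "law M P c \<le> law M Q c + p c" .
    have "law M Q c \<le> measure M ({x\<in>space M. P x = c} \<union> (D \<inter> {x\<in>space M. Q x = c}))"
      unfolding law_def using Ps Qs D that by (intro finite_measure_mono) (auto simp: D_def)
    also have "\<dots> \<le> law M P c + q c"
      unfolding law_def q_def using Ps Qs D that by (intro measure_Un_le) auto
    finally have 2: "law M Q c \<le> law M P c + q c" .
    have "0 \<le> p c" "0 \<le> q c" by (auto simp: p_def q_def)
    then show ?thesis using 1 2 by linarith
  qed
  then have "law_dist S M P M Q \<le> (\<Sum>c\<in>S. p c + q c)"
    unfolding law_dist_def by (rule sum_mono)
  also have "\<dots> = 2 * measure M D"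
    by (simp add: sum.distrib sp sq)
  finally show ?thesis unfolding D_def .
qed

section \<open>Labellings\<close>

definition part_label :: "nat \<Rightarrow> (nat \<Rightarrow> 'x set) \<Rightarrow> 'x \<Rightarrow> nat" where
  "part_label k A x = (THE j. j \<in> {1..k} \<and> x \<in> A j)"

text \<open>The map \<open>s\<close> may be the action or one stage of the sofic approximation.
  Restriction to \<open>F\<close> makes patterns extensional, so they range over the very functions
  \<open>F \<rightarrow>\<^sub>E {1..k}\<close> that index the sum in
  \<open>partition_dist\<close>.\<close>

definition pattern :: "('g \<Rightarrow> 'y \<Rightarrow> 'y) \<Rightarrow> 'g set \<Rightarrow> ('y \<Rightarrow> nat) \<Rightarrow> 'y \<Rightarrow> 'g \<Rightarrow> nat" where
  "pattern s F \<alpha> y = (\<lambda>f\<in>F. \<alpha> (s f y))"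

lemma pattern_in: "(\<And>f. f \<in> F \<Longrightarrow> \<alpha> (s f y) \<in> {1..k}) \<Longrightarrow> pattern s F \<alpha> y \<in> F \<rightarrow>\<^sub>E {1..k}"
  unfolding pattern_def by auto

lemma pattern_eq_iff: "\<phi> \<in> F \<rightarrow>\<^sub>E {1..k} \<Longrightarrow> pattern s F \<alpha> y = \<phi> \<longleftrightarrow> (\<forall>f\<in>F. \<alpha> (s f y) = \<phi> f)"
  unfolding pattern_def by (force simp: fun_eq_iff restrict_def PiE_def extensional_def)

lemma part_label:
  assumes "disjoint_family_on A {1..k}" "x \<in> (\<Union>j\<in>{1..k}. A j)"
  shows part_label_in: "part_label k A x \<in> {1..k}"
    and part_label_eq_iff: "j \<in> {1..k} \<Longrightarrow> part_label k A x = j \<longleftrightarrow> x \<in> A j"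
proof -
  have "\<exists>!j. j \<in> {1..k} \<and> x \<in> A j"
    using assms by (fastforce simp: disjoint_family_on_def)
  from theI'[OF this] this
  show "part_label k A x \<in> {1..k}" "j \<in> {1..k} \<Longrightarrow> part_label k A x = j \<longleftrightarrow> x \<in> A j"
    unfolding part_label_def by blast+
qed

lemma borel_partition_label:
  assumes "borel_partition k A"
  shows "part_label k A x \<in> {1..k}" "j \<in> {1..k} \<Longrightarrow> part_label k A x = j \<longleftrightarrow> x \<in> A j"
    "part_label k A \<in> measurable borel (count_space {1..k})"
proof -
  have d: "disjoint_family_on A {1..k}" "\<And>x. x \<in> (\<Union>j\<in>{1..k}. A j)"
    using assms by (auto simp: borel_partition_def)
  show 1: "part_label k A x \<in> {1..k}" "j \<in> {1..k} \<Longrightarrow> part_label k A x = j \<longleftrightarrow> x \<in> A j" for x j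
    using part_label[OF d] by blast+
  have "part_label k A -` {j} = A j" if "j \<in> {1..k}" for j
    using 1(2)[OF that] by auto
  then show "part_label k A \<in> measurable borel (count_space {1..k})"
    using assms 1(1) by (subst measurable_count_space_eq2) (auto simp: borel_partition_def)
qed

text \<open>Partitions of \<open>{1..n}\<close> are replaced by their labellings \<open>a\<close>.\<close>

definition approx_labellings ::
    "('g \<Rightarrow> 'x \<Rightarrow> 'x) \<Rightarrow> 'x measure \<Rightarrow> nat \<Rightarrow> ('g \<Rightarrow> nat \<Rightarrow> nat) \<Rightarrow> nat \<Rightarrow>
      ('x \<Rightarrow> nat) \<Rightarrow> 'g set \<Rightarrow> real \<Rightarrow> (nat \<Rightarrow> nat) set" where
  "approx_labellings act \<mu> n s k \<alpha> F \<epsilon> =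
     {a \<in> {1..n} \<rightarrow>\<^sub>E {1..k}. law_dist (F \<rightarrow>\<^sub>E {1..k}) \<mu> (pattern act F \<alpha>)
        (uniform_count_measure {1..n}) (pattern s F a) \<le> \<epsilon>}"

lemma bij_betw_labellings:
  "bij_betw (\<lambda>a. \<lambda>j\<in>{1..k}. {v\<in>{1..n}. a v = j}) ({1..n} \<rightarrow>\<^sub>E {1..k}) (indexed_partitions k n)"
proof (rule bij_betw_byWitness[where f' = "\<lambda>B. \<lambda>v\<in>{1..n}. part_label k B v"])
  show "\<forall>a\<in>{1..n} \<rightarrow>\<^sub>E {1..k}. (\<lambda>v\<in>{1..n}. part_label k (\<lambda>j\<in>{1..k}. {v\<in>{1..n}. a v = j}) v) = a"
  proof
    fix a assume a: "a \<in> {1..n} \<rightarrow>\<^sub>E {1..k}"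
    let ?B = "\<lambda>j\<in>{1..k}. {v\<in>{1..n}. a v = j}"
    have "part_label k ?B v = a v" if "v \<in> {1..n}" for v
    proof (subst part_label_eq_iff)
      show "disjoint_family_on ?B {1..k}" by (auto simp: disjoint_family_on_def)
      show "v \<in> (\<Union>j\<in>{1..k}. ?B j)" "a v \<in> {1..k}" "v \<in> ?B (a v)" using a that by auto
    qed
    then show "(\<lambda>v\<in>{1..n}. part_label k ?B v) = a"
      using a by (auto simp: fun_eq_iff PiE_def extensional_def)
  qed
  show "\<forall>B\<in>indexed_partitions k n.
      (\<lambda>j\<in>{1..k}. {v\<in>{1..n}. (\<lambda>v\<in>{1..n}. part_label k B v) v = j}) = B"
  proof
    fix B assume B: "B \<in> indexed_partitions k n"
    then have d: "disjoint_family_on B {1..k}" "\<And>v. v \<in> {1..n} \<Longrightarrow> v \<in> (\<Union>j\<in>{1..k}. B j)"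
      by (auto simp: indexed_partitions_def)
    have "{v\<in>{1..n}. (\<lambda>v\<in>{1..n}. part_label k B v) v = j} = B j" if "j \<in> {1..k}" for j
      using part_label_eq_iff[OF d(1) d(2) that] B that
      by (auto simp: indexed_partitions_def)
    then show "(\<lambda>j\<in>{1..k}. {v\<in>{1..n}. (\<lambda>v\<in>{1..n}. part_label k B v) v = j}) = B"
      using B by (auto simp: fun_eq_iff indexed_partitions_def PiE_def extensional_def)
  qed
  show "(\<lambda>a. \<lambda>j\<in>{1..k}. {v\<in>{1..n}. a v = j}) ` ({1..n} \<rightarrow>\<^sub>E {1..k}) \<subseteq> indexed_partitions k n"
    by (auto simp: indexed_partitions_def disjoint_family_on_def PiE_iff)
  show "(\<lambda>B. \<lambda>v\<in>{1..n}. part_label k B v) ` indexed_partitions k n \<subseteq> {1..n} \<rightarrow>\<^sub>E {1..k}"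
  proof (intro image_subsetI PiE_I)
    fix B v assume B: "B \<in> indexed_partitions k n" "v \<in> {1..n}"
    have "part_label k B v \<in> {1..k}"
      using B by (intro part_label_in) (auto simp: indexed_partitions_def)
    then show "(\<lambda>v\<in>{1..n}. part_label k B v) v \<in> {1..k}"
      using B by simp
  next
    fix B v assume "v \<notin> {1..n}"
    then show "(\<lambda>v\<in>{1..n}. part_label k B v) v = undefined"
      by (auto simp: restrict_def)
  qed
qed

text \<open>A point lies in the intersection attached to \<open>\<phi>\<close> exactly when its
  pattern is \<open>\<phi>\<close>, so the summands agree one by one.\<close>

lemma partition_dist_eq_law_dist:
  assumes A: "borel_partition k A" and "space \<mu> = UNIV"
    and F: "F \<noteq> {}" and s: "\<And>f. f \<in> F \<Longrightarrow> s f permutes {1..n}"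
    and a: "a \<in> {1..n} \<rightarrow>\<^sub>E {1..k}"
  shows "partition_dist act \<mu> n s k A F (\<lambda>j\<in>{1..k}. {v\<in>{1..n}. a v = j}) =
     law_dist (F \<rightarrow>\<^sub>E {1..k}) \<mu> (pattern act F (part_label k A))
        (uniform_count_measure {1..n}) (pattern s F a)"
  unfolding partition_dist_def law_dist_def law_def
proof (intro sum.cong arg_cong2[where f="\<lambda>x y. \<bar>x - y\<bar>"] arg_cong2[where f=measure] refl)
  fix \<phi> assume \<phi>: "\<phi> \<in> F \<rightarrow>\<^sub>E {1..k}"
  show "(\<Inter>f\<in>F. act f -` A (\<phi> f)) = {x\<in>space \<mu>. pattern act F (part_label k A) x = \<phi>}"
    using PiE_mem[OF \<phi>] borel_partition_label(2)[OF A] assms(2)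
    by (auto simp: pattern_eq_iff[OF \<phi>])
  \<comment> \<open>Preimages are taken in the whole type \<open>nat\<close>. Since \<open>F\<close>
    is non-empty and each \<open>s f\<close> preserves \<open>{1..n}\<close>, the intersection of
    preimages still lies in \<open>{1..n}\<close>.\<close>
  have "s f v \<in> {1..n} \<longleftrightarrow> v \<in> {1..n}" if "f \<in> F" for f v
    using permutes_in_image[OF s[OF that]] .
  then show "(\<Inter>f\<in>F. s f -` (\<lambda>j\<in>{1..k}. {v\<in>{1..n}. a v = j}) (\<phi> f)) =
      {x\<in>space (uniform_count_measure {1..n}). pattern s F a x = \<phi>}"
    using PiE_mem[OF \<phi>] F by (auto simp: pattern_eq_iff[OF \<phi>] space_uniform_count_measure)
qed

lemma card_AP_eq:
  assumes "borel_partition k A" "space \<mu> = UNIV"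
    and "F \<noteq> {}" "\<And>f. f \<in> F \<Longrightarrow> s f permutes {1..n}"
  shows "card (AP act \<mu> n s k A F \<epsilon>) = card (approx_labellings act \<mu> n s k (part_label k A) F \<epsilon>)"
proof -
  let ?h = "\<lambda>a::nat \<Rightarrow> nat. \<lambda>j\<in>{1..k}. {v\<in>{1..n}. a v = j}"
  note bij = bij_betw_labellings[where k=k and n=n]
  let ?L = "{1..n} \<rightarrow>\<^sub>E {1..k}"
  have surj: "?h ` ?L = indexed_partitions k n"
    by (rule bij_betw_imp_surj_on[OF bij])
  have "AP act \<mu> n s k A F \<epsilon> = {B \<in> ?h ` ?L. partition_dist act \<mu> n s k A F B \<le> \<epsilon>}"
    unfolding AP_def surj ..
  also have "\<dots> = ?h ` {a \<in> ?L. partition_dist act \<mu> n s k A F (?h a) \<le> \<epsilon>}"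
    by blast
  also have "{a \<in> ?L. partition_dist act \<mu> n s k A F (?h a) \<le> \<epsilon>} =
      approx_labellings act \<mu> n s k (part_label k A) F \<epsilon>"
    unfolding approx_labellings_def
    by (intro Collect_cong conj_cong refl) (simp only: partition_dist_eq_law_dist[OF assms])
  finally have "?h ` approx_labellings act \<mu> n s k (part_label k A) F \<epsilon> = AP act \<mu> n s k A F \<epsilon>"
    by (rule sym)
  moreover have "inj_on ?h (approx_labellings act \<mu> n s k (part_label k A) F \<epsilon>)"
    using bij_betw_imp_inj_on[OF bij] by (rule inj_on_subset) (unfold approx_labellings_def, rule Collect_restrict)
  ultimately show ?thesis
    by (metis (no_types) card_image)
qed

text \<open>A labelling that differs from \<open>c\<close> at \<open>j\<close> points gets the weight \<open>t ^ j\<close>; the total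
  weight is a product over the points.\<close>

lemma card_Hamming_ball_le:
  fixes t \<kappa> :: real
  assumes t: "0 < t" "t \<le> 1" and "0 \<le> \<kappa>"
  shows "real (card {a \<in> {1..n::nat} \<rightarrow>\<^sub>E {1..k::nat}. real (card {v\<in>{1..n::nat}. a v \<noteq> c v}) \<le> \<kappa> * real n})
    \<le> exp (real n * (\<kappa> * ln (1 / t) + k * t))" (is "real (card ?B) \<le> _")
proof -
  let ?w = "\<lambda>j v. if j = c v then 1 else t"
  have fin: "finite ({1..n::nat} \<rightarrow>\<^sub>E {1..k})"
    by (simp add: finite_PiE)
  \<comment> \<open>At most \<open>\<kappa> * n\<close> factors equal \<open>t\<close> and the
    others equal 1; as \<open>t \<le> 1\<close>, fewer errors only increase the weight.\<close>
  have "t powr (\<kappa> * real n) \<le> (\<Prod>v\<in>{1..n::nat}. ?w (a v) v)" if "a \<in> ?B" for a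
  proof -
    have "(\<Prod>v\<in>{1..n::nat}. ?w (a v) v) = t ^ card {v\<in>{1..n::nat}. a v \<noteq> c v}"
      by (subst prod.If_cases) (auto simp: Int_def)
    also have "\<dots> = t powr (card {v\<in>{1..n::nat}. a v \<noteq> c v})"
      using t by (simp add: powr_realpow)
    also have "\<dots> \<ge> t powr (\<kappa> * real n)"
      using that t by (intro powr_mono') auto
    finally show ?thesis .
  qed
  then have "(\<Sum>a\<in>?B. t powr (\<kappa> * real n)) \<le> (\<Sum>a\<in>?B. \<Prod>v\<in>{1..n::nat}. ?w (a v) v)"
    by (rule sum_mono)
  also have "\<dots> \<le> (\<Sum>a\<in>{1..n::nat} \<rightarrow>\<^sub>E {1..k}. \<Prod>v\<in>{1..n::nat}. ?w (a v) v)"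
    using t fin by (intro sum_mono2) (auto intro!: prod_nonneg)
  also have "\<dots> = (\<Prod>v\<in>{1..n::nat}. \<Sum>j\<in>{1..k}. ?w j v)"
    by (subst prod_sum_PiE[symmetric]) auto
  also have "\<dots> \<le> (\<Prod>v\<in>{1..n::nat}. 1 + k * t)"
  proof (intro prod_mono conjI)
    fix v assume "v \<in> {1..n::nat}"
    show "0 \<le> (\<Sum>j\<in>{1..k}. ?w j v)" using t by (auto intro!: sum_nonneg)
    \<comment> \<open>At most one label \<open>j\<close> equals \<open>c v\<close>, and none does if
      \<open>c v\<close> is outside \<open>{1..k}\<close>.\<close>
    have "(\<Sum>j\<in>{1..k}. ?w j v) \<le> (\<Sum>j\<in>{1..k}. (if j = c v then 1 else 0) + t)"
      using t by (intro sum_mono) auto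
    also have "\<dots> \<le> 1 + k * t"
      by (simp add: sum.distrib)
    finally show "(\<Sum>j\<in>{1..k}. ?w j v) \<le> 1 + k * t" .
  qed
  also have "\<dots> = (1 + k * t) ^ n" by simp
  also have "\<dots> \<le> exp (k * t) ^ n"
    using t by (intro power_mono) auto
  also have "\<dots> = exp (real n * (k * t))"
    by (simp add: exp_of_nat_mult)
  finally have "card ?B * t powr (\<kappa> * real n) \<le> exp (real n * (k * t))"
    by simp
  then have "card ?B \<le> exp (real n * (k * t)) / t powr (\<kappa> * real n)"
    using t by (simp add: field_simps)
  also have "\<dots> = exp (real n * (\<kappa> * ln (1 / t) + k * t))"
    using t by (simp add: powr_def ln_div exp_diff[symmetric] algebra_simps)
  finally show ?thesis .
qed

text \<open>The two terms of the exponent in \<open>card_Hamming_ball_le\<close> are made at most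
  \<open>r / 2\<close> each, first by a small \<open>t\<close> and then by a small
  \<open>\<kappa>\<close>. The radius depends on neither \<open>n\<close> nor the centre, which lets
  it be fixed before the sofic index.\<close>

lemma exists_Hamming_radius:
  assumes "0 < (r::real)"
  shows "\<exists>\<kappa>>0. \<forall>n c. real (card {a \<in> {1..n::nat} \<rightarrow>\<^sub>E {1..k::nat}. real (card {v\<in>{1..n::nat}. a v \<noteq> c v}) \<le> \<kappa> * real n})
    \<le> exp (real n * r)"
proof -
  \<comment> \<open>The bound \<open>1/2\<close> keeps \<open>ln (1 / t)\<close> positive, so that
    it may be divided by; \<open>k + 1\<close> avoids a zero denominator.\<close>
  define t where "t = min (1/2) (r / (2 * (k + 1)))"
  have t: "0 < t" "t \<le> 1" "t < 1" using assms by (auto simp: t_def)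
  have "k * t \<le> (k + 1) * (r / (2 * (k + 1)))"
    using assms t by (intro mult_mono) (auto simp: t_def)
  also have "\<dots> = r / 2" by (simp add: divide_simps)
  finally have kt: "k * t \<le> r / 2" .
  define \<kappa> where "\<kappa> = r / (2 * ln (1 / t))"
  have "ln (1 / t) > 0" using t by (intro ln_gt_zero) auto
  then have \<kappa>: "\<kappa> > 0" "\<kappa> * ln (1 / t) = r / 2" using assms by (auto simp: \<kappa>_def)
  have "real (card {a \<in> {1..n::nat} \<rightarrow>\<^sub>E {1..k::nat}. real (card {v\<in>{1..n::nat}. a v \<noteq> c v}) \<le> \<kappa> * real n})
    \<le> exp (real n * r)" for n c
  proof -
    have "real n * (\<kappa> * ln (1 / t) + k * t) \<le> real n * r"
      using kt \<kappa> by (intro mult_left_mono) auto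
    then show ?thesis
      using card_Hamming_ball_le[OF t(1,2), of \<kappa> n k c] \<kappa>(1) by (smt (verit) exp_le_cancel_iff)
  qed
  then show ?thesis using \<kappa>(1) by blast
qed

lemma measurable_uniform_count_measure:
  "P \<in> A \<rightarrow> S \<Longrightarrow> P \<in> measurable (uniform_count_measure A) (count_space S)"
  by (auto simp: measurable_def space_uniform_count_measure sets_uniform_count_measure)

section \<open>Codes between generating partitions\<close>

locale invariant_measure =
  fixes G :: "('g, 'm) monoid_scheme" and act :: "'g \<Rightarrow> 'x::topological_space \<Rightarrow> 'x"
    and \<mu> :: "'x measure"
  assumes group: "group G" and action: "continuous_action G act"
    and invariant: "\<mu> \<in> invariant_measures G act"
begin

sublocale group G by (rule group)

sublocale prob_space \<mu>
  using invariant by (simp add: invariant_measures_def borel_prob_measures_def)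

lemma sets_eq: "sets \<mu> = sets borel"
  using invariant by (simp add: invariant_measures_def borel_prob_measures_def)

lemma space_eq: "space \<mu> = UNIV"
  using sets_eq_imp_space_eq[OF sets_eq] by simp

lemma measurable_\<mu>: "measurable \<mu> N = measurable borel N"
  by (rule measurable_cong_sets) (auto simp: sets_eq)

lemma act_mult: "g \<in> carrier G \<Longrightarrow> h \<in> carrier G \<Longrightarrow> act (g \<otimes>\<^bsub>G\<^esub> h) x = act g (act h x)"
  using action group_action.composition_rule[of G UNIV act] by (simp add: continuous_action_def)

lemma act_one: "act \<one>\<^bsub>G\<^esub> x = x"
proof -
  interpret group_action G UNIV act using action by (simp add: continuous_action_def)
  show ?thesis using id_eq_one by (simp add: fun_eq_iff)
qed

lemma act_inv: "g \<in> carrier G \<Longrightarrow> act (inv\<^bsub>G\<^esub> g) (act g x) = x"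
  "g \<in> carrier G \<Longrightarrow> act g (act (inv\<^bsub>G\<^esub> g) x) = x"
  by (simp_all flip: act_mult add: act_one)

lemma measurable_act: "g \<in> carrier G \<Longrightarrow> act g \<in> measurable borel borel"
  using action by (intro borel_measurable_continuous_onI) (simp add: continuous_action_def)

lemma act_vimage_sets: "g \<in> carrier G \<Longrightarrow> C \<in> sets borel \<Longrightarrow> act g -` C \<in> sets borel"
  using measurable_sets[OF measurable_act] by force

lemma measure_act_vimage:
  assumes "g \<in> carrier G" "C \<in> sets borel"
  shows "measure \<mu> (act g -` C) = measure \<mu> C"
proof -
  have "measure \<mu> C = measure (distr \<mu> borel (act g)) C"
    using invariant assms by (simp add: invariant_measures_def)
  also have "\<dots> = measure \<mu> (act g -` C)"
    using assms measurable_act by (subst measure_distr) (auto simp: measurable_\<mu> space_eq)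
  finally show ?thesis by simp
qed

lemma measurable_label_act:
  assumes "\<alpha> \<in> measurable borel (count_space S)" "g \<in> carrier G"
  shows "(\<lambda>x. \<alpha> (act g x)) \<in> measurable borel (count_space S)"
  using measurable_compose[OF measurable_act[OF assms(2)] assms(1)] .

lemma label_in: "\<alpha> \<in> measurable borel (count_space S) \<Longrightarrow> \<alpha> (x::'x) \<in> S"
  using measurable_space[of \<alpha> borel "count_space S" x] by simp

lemma label_vimage_sets:
  "(\<alpha> :: 'x \<Rightarrow> 'b) \<in> measurable borel (count_space S) \<Longrightarrow> {x. \<alpha> x \<in> T} \<in> sets borel"
  using measurable_sets[of \<alpha> borel "count_space S" "T \<inter> S"] label_in[of \<alpha> S]
  by (simp add: vimage_def)

lemma measurable_pattern:
  assumes "\<alpha> \<in> measurable borel (count_space {1..k})" "finite F" "F \<subseteq> carrier G"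
  shows "pattern act F \<alpha> \<in> measurable borel (count_space (F \<rightarrow>\<^sub>E {1..k}))"
proof (subst measurable_count_space_eq2, goal_cases)
  case 1
  show ?case using assms by (simp add: finite_PiE)
next
  case 2
  show ?case
  proof (intro conjI ballI Pi_I)
    show "pattern act F \<alpha> x \<in> F \<rightarrow>\<^sub>E {1..k}" for x
      by (rule pattern_in) (rule label_in[OF assms(1)])
    fix \<phi> assume \<phi>: "\<phi> \<in> F \<rightarrow>\<^sub>E {1..k}"
    have "{x \<in> space borel. \<forall>f\<in>F. \<alpha> (act f x) = \<phi> f} \<in> sets borel"
    proof (rule sets.sets_Collect_finite_All[OF _ \<open>finite F\<close>])
      fix f assume "f \<in> F"
      then show "{x \<in> space borel. \<alpha> (act f x) = \<phi> f} \<in> sets borel"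
        using label_vimage_sets[OF measurable_label_act[OF assms(1)], of f "{\<phi> f}"] assms(3) by auto
    qed
    then show "pattern act F \<alpha> -` {\<phi>} \<inter> space borel \<in> sets borel"
      by (simp add: vimage_def pattern_eq_iff[OF \<phi>])
  qed
qed

section \<open>Approximation of measurable sets by cylinders\<close>

definition cylinder :: "'g set \<Rightarrow> ('x \<Rightarrow> nat) \<Rightarrow> 'x set \<Rightarrow> bool" where
  "cylinder F \<alpha> C \<longleftrightarrow> (\<forall>x y. pattern act F \<alpha> x = pattern act F \<alpha> y \<longrightarrow> x \<in> C \<longrightarrow> y \<in> C)"

text \<open>The defining implication becomes an equivalence by exchanging \<open>x\<close> and
  \<open>y\<close>. Cylinders are thus the unions of fibres of the pattern map.\<close>

lemma cylinderD: "cylinder F \<alpha> C \<Longrightarrow> pattern act F \<alpha> x = pattern act F \<alpha> y \<Longrightarrow> x \<in> C \<longleftrightarrow> y \<in> C"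
  unfolding cylinder_def by metis

lemma pattern_eq_mono:
  "pattern act F' \<alpha> x = pattern act F' \<alpha> y \<Longrightarrow> F \<subseteq> F' \<Longrightarrow> pattern act F \<alpha> x = pattern act F \<alpha> y"
  unfolding pattern_def fun_eq_iff restrict_def by (metis subsetD)

lemma cylinder_mono: "cylinder F \<alpha> C \<Longrightarrow> F \<subseteq> F' \<Longrightarrow> cylinder F' \<alpha> C"
  unfolding cylinder_def using pattern_eq_mono by blast

lemma cylinder_sets:
  assumes "\<alpha> \<in> measurable borel (count_space {1..k})" "finite F" "F \<subseteq> carrier G" "cylinder F \<alpha> C"
  shows "C \<in> sets borel"
proof -
  have "{x. pattern act F \<alpha> x \<in> pattern act F \<alpha> ` C} \<in> sets borel"
    by (rule label_vimage_sets[OF measurable_pattern[OF assms(1-3)]])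
  also have "{x. pattern act F \<alpha> x \<in> pattern act F \<alpha> ` C} = C"
    using cylinderD[OF assms(4)] by blast
  finally show ?thesis .
qed

text \<open>The closure of the cylinders over finite windows in the pseudometric given by the
  measure of the symmetric difference.\<close>

definition approximable :: "('x \<Rightarrow> nat) \<Rightarrow> 'x set set" where
  "approximable \<alpha> = {B \<in> sets borel. \<forall>\<eta>>0. \<exists>F C. finite F \<and> F \<subseteq> carrier G \<and> cylinder F \<alpha> C \<and>
      measure \<mu> ((B - C) \<union> (C - B)) < \<eta>}"

lemma approximableD:
  assumes "B \<in> approximable \<alpha>" "\<eta> > 0"
  obtains F C where "finite F" "F \<subseteq> carrier G" "cylinder F \<alpha> C"
    "measure \<mu> ((B - C) \<union> (C - B)) < \<eta>"
  using assms unfolding approximable_def by blast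

text \<open>A closure is closed: this is the triangle inequality for symmetric differences, with
  \<open>\<eta> / 2\<close> spent on each step.\<close>

lemma approximable_limit:
  assumes \<alpha>: "\<alpha> \<in> measurable borel (count_space {1..k})"
    and B: "B \<in> sets borel"
    and lim: "\<And>\<eta>. \<eta> > 0 \<Longrightarrow> \<exists>D\<in>approximable \<alpha>. measure \<mu> ((B - D) \<union> (D - B)) < \<eta>"
  shows "B \<in> approximable \<alpha>"
  unfolding approximable_def
proof (intro CollectI conjI allI impI)
  fix \<eta> :: real assume "\<eta> > 0"
  then have \<eta>: "\<eta> / 2 > 0" by simp
  obtain D where D: "D \<in> approximable \<alpha>" "measure \<mu> ((B - D) \<union> (D - B)) < \<eta> / 2"
    using lim[OF \<eta>] by blast
  obtain F C where FC: "finite F" "F \<subseteq> carrier G" "cylinder F \<alpha> C"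
    "measure \<mu> ((D - C) \<union> (C - D)) < \<eta> / 2"
    using approximableD[OF D(1) \<eta>] .
  have sets: "D \<in> sets \<mu>" "C \<in> sets \<mu>" "B \<in> sets \<mu>"
    using D(1) cylinder_sets[OF \<alpha> FC(1-3)] B by (auto simp: approximable_def sets_eq)
  have "measure \<mu> ((B - C) \<union> (C - B)) \<le>
      measure \<mu> (((B - D) \<union> (D - B)) \<union> ((D - C) \<union> (C - D)))"
    using sets by (intro finite_measure_mono) auto
  also have "\<dots> \<le> measure \<mu> ((B - D) \<union> (D - B)) + measure \<mu> ((D - C) \<union> (C - D))"
    using sets by (intro measure_Un_le) auto
  also have "\<dots> < \<eta>" using D(2) FC(4) by simp
  finally show "\<exists>F C. finite F \<and> F \<subseteq> carrier G \<and> cylinder F \<alpha> C \<and>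
      measure \<mu> ((B - C) \<union> (C - B)) < \<eta>"
    using FC by blast
qed (rule B)

lemma approximable_Un:
  assumes \<alpha>: "\<alpha> \<in> measurable borel (count_space {1..k})"
    and "A \<in> approximable \<alpha>" "B \<in> approximable \<alpha>"
  shows "A \<union> B \<in> approximable \<alpha>"
  unfolding approximable_def
proof (intro CollectI conjI allI impI)
  show "A \<union> B \<in> sets borel" using assms by (auto simp: approximable_def)
  fix \<eta> :: real assume "\<eta> > 0"
  then have \<eta>: "\<eta> / 2 > 0" by simp
  obtain F C where FC: "finite F" "F \<subseteq> carrier G" "cylinder F \<alpha> C"
    "measure \<mu> ((A - C) \<union> (C - A)) < \<eta> / 2"
    using approximableD[OF assms(2) \<eta>] .
  obtain E D where ED: "finite E" "E \<subseteq> carrier G" "cylinder E \<alpha> D"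
    "measure \<mu> ((B - D) \<union> (D - B)) < \<eta> / 2"
    using approximableD[OF assms(3) \<eta>] .
  have sets: "D \<in> sets \<mu>" "C \<in> sets \<mu>" "A \<in> sets \<mu>" "B \<in> sets \<mu>"
    using cylinder_sets[OF \<alpha> FC(1-3)] cylinder_sets[OF \<alpha> ED(1-3)] assms
    by (auto simp: approximable_def sets_eq)
  have "measure \<mu> ((A \<union> B - (C \<union> D)) \<union> (C \<union> D - (A \<union> B))) \<le>
      measure \<mu> (((A - C) \<union> (C - A)) \<union> ((B - D) \<union> (D - B)))"
    using sets by (intro finite_measure_mono) auto
  also have "\<dots> \<le> measure \<mu> ((A - C) \<union> (C - A)) + measure \<mu> ((B - D) \<union> (D - B))"
    using sets by (intro measure_Un_le) auto
  also have "\<dots> < \<eta>" using ED(4) FC(4) by simp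
  finally have "measure \<mu> ((A \<union> B - (C \<union> D)) \<union> (C \<union> D - (A \<union> B))) < \<eta>" .
  moreover have "cylinder (F \<union> E) \<alpha> (C \<union> D)"
    using cylinder_mono[OF FC(3), of "F \<union> E"] cylinder_mono[OF ED(3), of "F \<union> E"]
    unfolding cylinder_def by blast
  ultimately show "\<exists>F Z. finite F \<and> F \<subseteq> carrier G \<and> cylinder F \<alpha> Z \<and>
      measure \<mu> ((A \<union> B - Z) \<union> (Z - (A \<union> B))) < \<eta>"
    using FC ED by (intro exI[of _ "F \<union> E"] exI[of _ "C \<union> D"]) auto
qed

lemma cylinder_approximable:
  assumes "\<alpha> \<in> measurable borel (count_space {1..k})" "finite F" "F \<subseteq> carrier G" "cylinder F \<alpha> C"
  shows "C \<in> approximable \<alpha>"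
proof -
  have "measure \<mu> ((C - C) \<union> (C - C)) = 0" by simp
  then show ?thesis
    unfolding approximable_def using assms cylinder_sets[OF assms] by (smt (verit) CollectI)
qed

text \<open>Complementation leaves symmetric differences unchanged. Finite unions are covered by
  \<open>approximable_Un\<close>, and a countable union is a limit of its finite partial unions by
  continuity of the measure from below.\<close>

lemma sigma_algebra_approximable:
  assumes \<alpha>: "\<alpha> \<in> measurable borel (count_space {1..k})"
  shows "sigma_algebra UNIV (approximable \<alpha>)"
  unfolding sigma_algebra_iff2
proof (intro conjI ballI allI impI)
  show "approximable \<alpha> \<subseteq> Pow UNIV" by simp
  show empty: "{} \<in> approximable \<alpha>"
    using \<alpha> by (rule cylinder_approximable[where F = "{}"]) (auto simp: cylinder_def)
  show "UNIV - B \<in> approximable \<alpha>" if B: "B \<in> approximable \<alpha>" for B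
    unfolding approximable_def
  proof (intro CollectI conjI allI impI)
    show "UNIV - B \<in> sets borel" using B by (auto simp: approximable_def)
    fix \<eta> :: real assume "\<eta> > 0"
    then obtain F C where FC: "finite F" "F \<subseteq> carrier G" "cylinder F \<alpha> C"
      "measure \<mu> ((B - C) \<union> (C - B)) < \<eta>"
      using approximableD[OF B] by blast
    moreover have "(UNIV - B - (UNIV - C)) \<union> (UNIV - C - (UNIV - B)) = (B - C) \<union> (C - B)"
      by blast
    moreover have "cylinder F \<alpha> (UNIV - C)"
      unfolding cylinder_def using cylinderD[OF FC(3)] by blast
    ultimately show "\<exists>F C. finite F \<and> F \<subseteq> carrier G \<and> cylinder F \<alpha> C \<and>
        measure \<mu> ((UNIV - B - C) \<union> (C - (UNIV - B))) < \<eta>"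
      by (intro exI[of _ F] exI[of _ "UNIV - C"]) simp
  qed
  fix B :: "nat \<Rightarrow> 'x set" assume B: "range B \<subseteq> approximable \<alpha>"
  then have Bs: "B i \<in> sets borel" for i by (auto simp: approximable_def)
  have fin: "(\<Union>i<n. B i) \<in> approximable \<alpha>" for n
  proof (induction n)
    case (Suc n)
    then show ?case
      using approximable_Un[OF \<alpha>, of "B n" "\<Union>i<n. B i"] B by (auto simp: lessThan_Suc)
  qed (simp add: empty)
  show "(\<Union>i. B i) \<in> approximable \<alpha>"
  proof (rule approximable_limit[OF \<alpha>])
    show "(\<Union>i. B i) \<in> sets borel" using Bs by auto
    fix \<eta> :: real assume "\<eta> > 0"
    have "(\<lambda>n. measure \<mu> (\<Union>i<n. B i)) \<longlonglongrightarrow> measure \<mu> (\<Union>n. \<Union>i<n. B i)"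
      using Bs by (intro finite_Lim_measure_incseq) (auto simp: sets_eq incseq_def, force)
    also have "(\<Union>n. \<Union>i<n. B i) = (\<Union>i. B i)" by auto
    finally have "eventually (\<lambda>n. measure \<mu> (\<Union>i<n. B i) > measure \<mu> (\<Union>i. B i) - \<eta>) sequentially"
      using \<open>\<eta> > 0\<close> by (intro order_tendstoD) auto
    then obtain n where n: "measure \<mu> (\<Union>i<n. B i) > measure \<mu> (\<Union>i. B i) - \<eta>"
      by (auto simp: eventually_sequentially)
    let ?D = "\<Union>i<n. B i"
    have "((\<Union>i. B i) - ?D) \<union> (?D - (\<Union>i. B i)) = (\<Union>i. B i) - ?D" by auto
    then have "measure \<mu> (((\<Union>i. B i) - ?D) \<union> (?D - (\<Union>i. B i))) = measure \<mu> (\<Union>i. B i) - measure \<mu> ?D"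
      using Bs by (simp only:) (intro finite_measure_Diff, auto simp: sets_eq)
    then show "\<exists>D\<in>approximable \<alpha>. measure \<mu> (((\<Union>i. B i) - D) \<union> (D - (\<Union>i. B i))) < \<eta>"
      using n fin by (intro bexI[of _ ?D]) auto
  qed
qed

text \<open>The image under \<open>g\<close> is the preimage under the inverse of \<open>g\<close>.
  Taking preimages turns cylinders into cylinders over a translated window, and invariance of
  \<open>\<mu>\<close> preserves the error.\<close>

lemma approximable_image_act:
  assumes \<alpha>: "\<alpha> \<in> measurable borel (count_space {1..k})" and g: "g \<in> carrier G"
    and B: "B \<in> approximable \<alpha>"
  shows "act g ` B \<in> approximable \<alpha>"
proof -
  let ?h = "inv\<^bsub>G\<^esub> g"
  have h: "?h \<in> carrier G" using g by simp
  have img: "act g ` B = act ?h -` B"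
  proof (intro equalityI subsetI)
    fix x assume "x \<in> act ?h -` B"
    then show "x \<in> act g ` B" using act_inv(2)[OF g, of x] by (intro image_eqI[of _ _ "act ?h x"]) auto
  qed (auto simp: act_inv[OF g])
  show ?thesis
    unfolding img approximable_def
  proof (intro CollectI conjI allI impI)
    show "act ?h -` B \<in> sets borel"
      using act_vimage_sets[OF h] B by (auto simp: approximable_def)
    fix \<eta> :: real assume "\<eta> > 0"
    then obtain F C where FC: "finite F" "F \<subseteq> carrier G" "cylinder F \<alpha> C"
      "measure \<mu> ((B - C) \<union> (C - B)) < \<eta>"
      using approximableD[OF B] by blast
    \<comment> \<open>On this window the pattern of \<open>x\<close> records what the pattern on
      \<open>F\<close> records at \<open>act ?h x\<close>.\<close>
    let ?F = "(\<lambda>f. f \<otimes>\<^bsub>G\<^esub> ?h) ` F"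
    have "cylinder ?F \<alpha> (act ?h -` C)"
      unfolding cylinder_def
    proof (intro allI impI)
      fix x y assume eq: "pattern act ?F \<alpha> x = pattern act ?F \<alpha> y" and x: "x \<in> act ?h -` C"
      have "\<alpha> (act f (act ?h x)) = \<alpha> (act f (act ?h y))" if f: "f \<in> F" for f
      proof -
        have "\<alpha> (act (f \<otimes>\<^bsub>G\<^esub> ?h) x) = \<alpha> (act (f \<otimes>\<^bsub>G\<^esub> ?h) y)"
          using fun_cong[OF eq, of "f \<otimes>\<^bsub>G\<^esub> ?h"] f by (simp add: pattern_def)
        then show ?thesis using f FC(2) h by (auto simp: act_mult)
      qed
      then have pat: "pattern act F \<alpha> (act ?h x) = pattern act F \<alpha> (act ?h y)"
        by (auto simp: pattern_def)
      then show "y \<in> act ?h -` C"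
        using cylinderD[OF FC(3) pat] x by simp
    qed
    moreover have "(act ?h -` B - act ?h -` C) \<union> (act ?h -` C - act ?h -` B) =
        act ?h -` ((B - C) \<union> (C - B))" by blast
    moreover have "(B - C) \<union> (C - B) \<in> sets borel"
      using B cylinder_sets[OF \<alpha> FC(1-3)] by (auto simp: approximable_def)
    then have "measure \<mu> (act ?h -` ((B - C) \<union> (C - B))) < \<eta>"
      using FC(4) by (simp only: measure_act_vimage[OF h])
    moreover have "finite ?F" "?F \<subseteq> carrier G" using FC h by auto
    ultimately show "\<exists>F C. finite F \<and> F \<subseteq> carrier G \<and> cylinder F \<alpha> C \<and>
        measure \<mu> ((act ?h -` B - C) \<union> (C - act ?h -` B)) < \<eta>"
      by (intro exI[of _ ?F] exI[of _ "act ?h -` C"]) simp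
  qed
qed

text \<open>The approximable sets form an invariant \<sigma>-algebra containing the blocks, hence
  contain the smallest one. The null set by which \<open>B\<close> differs from a member of the
  latter is absorbed by \<open>approximable_limit\<close>.\<close>

lemma generating_approximable:
  assumes A: "borel_partition k A" and gen: "generating G act \<mu> k A" and B: "B \<in> sets borel"
  shows "B \<in> approximable (part_label k A)"
proof -
  note \<alpha> = borel_partition_label(3)[OF A]
  have "A j \<in> approximable (part_label k A)" if j: "j \<in> {1..k}" for j
  proof (rule cylinder_approximable[OF \<alpha>, of "{\<one>\<^bsub>G\<^esub>}"])
    show "cylinder {\<one>\<^bsub>G\<^esub>} (part_label k A) (A j)"
      unfolding cylinder_def
    proof (intro allI impI)
      fix x y assume "pattern act {\<one>\<^bsub>G\<^esub>} (part_label k A) x = pattern act {\<one>\<^bsub>G\<^esub>} (part_label k A) y"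
      from fun_cong[OF this, of "\<one>\<^bsub>G\<^esub>"] have "part_label k A x = part_label k A y"
        by (simp add: pattern_def act_one)
      moreover assume "x \<in> A j"
      ultimately show "y \<in> A j" using borel_partition_label(2)[OF A j] by metis
    qed
  qed auto
  then have "invariant_sigma_algebra G act k A \<subseteq> approximable (part_label k A)"
    unfolding invariant_sigma_algebra_def
    using sigma_algebra_approximable[OF \<alpha>] approximable_image_act[OF \<alpha>]
    by (intro Inter_lower) (auto simp: approximable_def)
  moreover obtain C where "C \<in> invariant_sigma_algebra G act k A" "measure \<mu> ((C - B) \<union> (B - C)) = 0"
    using gen B unfolding generating_def by blast
  ultimately have "C \<in> approximable (part_label k A)" "measure \<mu> ((B - C) \<union> (C - B)) = 0"
    by (auto simp: Un_commute)
  then have "\<exists>D\<in>approximable (part_label k A). measure \<mu> ((B - D) \<union> (D - B)) < \<eta>" if "\<eta> > 0" for \<eta>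
    using that by (intro bexI[of _ C]) simp_all
  then show ?thesis
    by (intro approximable_limit[OF \<alpha> B])
qed

text \<open>Each level set of \<open>\<beta>\<close> is approximated by a cylinder with error below
  \<open>\<eta> / l\<close>. Over a common window, the code picks a label whose cylinder contains
  the point; it can err only inside one of the \<open>l\<close> symmetric differences. The set
  \<open>D\<close> allows a caller to force elements into the window.\<close>

lemma generating_code:
  fixes \<beta> :: "'x \<Rightarrow> nat"
  assumes A: "borel_partition k A" and gen: "generating G act \<mu> k A"
    and \<beta>: "\<beta> \<in> measurable borel (count_space {1..l})" and "\<eta> > 0"
    and D: "finite D" "D \<subseteq> carrier G"
  shows "\<exists>F \<Phi>. finite F \<and> F \<subseteq> carrier G \<and> D \<subseteq> F \<and> (\<forall>\<phi>. \<Phi> \<phi> \<in> {1..l}) \<and>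
    measure \<mu> {x. \<beta> x \<noteq> \<Phi> (pattern act F (part_label k A) x)} < \<eta>"
proof -
  let ?\<alpha> = "part_label k A"
  note \<alpha> = borel_partition_label(3)[OF A]
  have "1 \<le> l" using label_in[OF \<beta>, of undefined] by auto
  have "\<forall>j. \<exists>F C. finite F \<and> F \<subseteq> carrier G \<and> cylinder F ?\<alpha> C \<and>
      measure \<mu> (({x. \<beta> x = j} - C) \<union> (C - {x. \<beta> x = j})) < \<eta> / l"
  proof
    fix j
    have "{x. \<beta> x = j} \<in> sets borel" using label_vimage_sets[OF \<beta>, of "{j}"] by simp
    from approximableD[OF generating_approximable[OF A gen this], of "\<eta> / l"]
    show "\<exists>F C. finite F \<and> F \<subseteq> carrier G \<and> cylinder F ?\<alpha> C \<and>
      measure \<mu> (({x. \<beta> x = j} - C) \<union> (C - {x. \<beta> x = j})) < \<eta> / l"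
      using \<open>\<eta> > 0\<close> \<open>1 \<le> l\<close> by (metis divide_pos_pos of_nat_0_less_iff less_le_trans zero_less_one)
  qed
  then obtain F C where FC: "\<And>j. finite (F j)" "\<And>j. F j \<subseteq> carrier G" "\<And>j. cylinder (F j) ?\<alpha> (C j)"
    "\<And>j. measure \<mu> (({x. \<beta> x = j} - C j) \<union> (C j - {x. \<beta> x = j})) < \<eta> / l"
    by metis
  define E where "E = D \<union> (\<Union>j\<in>{1..l}. F j)"
  have E: "finite E" "E \<subseteq> carrier G" "D \<subseteq> E"
    using FC D by (auto simp: E_def)
  \<comment> \<open>The cylinders may overlap or fail to cover. In the first case any admissible
    label will do, in the second the default is 1, which is a label because
    \<open>1 \<le> l\<close>.\<close>
  define \<gamma> where "\<gamma> x = (if \<exists>j\<in>{1..l}. x \<in> C j then SOME j. j \<in> {1..l} \<and> x \<in> C j else 1)" for x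
  have \<gamma>_in: "\<gamma> x \<in> {1..l}" for x
  proof (cases "\<exists>j\<in>{1..l}. x \<in> C j")
    case True
    then have "\<exists>j. j \<in> {1..l} \<and> x \<in> C j" by blast
    from someI_ex[OF this] show ?thesis using True by (simp add: \<gamma>_def)
  next
    case False
    then show ?thesis using \<open>1 \<le> l\<close> by (auto simp: \<gamma>_def)
  qed
  have \<gamma>_cong: "\<gamma> x = \<gamma> y" if "pattern act E ?\<alpha> x = pattern act E ?\<alpha> y" for x y
  proof -
    have "F j \<subseteq> E" if "j \<in> {1..l}" for j using that by (auto simp: E_def)
    then have "j \<in> {1..l} \<and> x \<in> C j \<longleftrightarrow> j \<in> {1..l} \<and> y \<in> C j" for j
      using cylinderD[OF cylinder_mono[OF FC(3)[of j], of E] that] by blast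
    then show ?thesis by (simp only: \<gamma>_def Bex_def)
  qed
  \<comment> \<open>Since \<open>\<gamma>\<close> depends only on the pattern, it can be evaluated
    at any point with that pattern. An argument that is no pattern of a point still gets a value of
    \<open>\<gamma>\<close>, hence a label.\<close>
  define \<Phi> where "\<Phi> \<phi> = \<gamma> (SOME x. pattern act E ?\<alpha> x = \<phi>)" for \<phi>
  have \<Phi>: "\<Phi> (pattern act E ?\<alpha> x) = \<gamma> x" for x
    unfolding \<Phi>_def by (rule \<gamma>_cong, rule someI) (rule refl)
  have sets: "({x. \<beta> x = j} - C j) \<union> (C j - {x. \<beta> x = j}) \<in> sets \<mu>" for j
    using label_vimage_sets[OF \<beta>, of "{j}"] cylinder_sets[OF \<alpha> FC(1-3), of j] by (auto simp: sets_eq)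
  have sub: "{x. \<beta> x \<noteq> \<gamma> x} \<subseteq> (\<Union>j\<in>{1..l}. ({x. \<beta> x = j} - C j) \<union> (C j - {x. \<beta> x = j}))"
  proof (rule subsetI, rule ccontr)
    fix x assume x: "x \<in> {x. \<beta> x \<noteq> \<gamma> x}"
      and "x \<notin> (\<Union>j\<in>{1..l}. ({x. \<beta> x = j} - C j) \<union> (C j - {x. \<beta> x = j}))"
    \<comment> \<open>Outside all symmetric differences, \<open>\<beta> x\<close> is the only label
      whose cylinder contains \<open>x\<close>, so the choice in \<open>\<gamma>\<close> is
      forced.\<close>
    then have iff: "x \<in> C j \<longleftrightarrow> \<beta> x = j" if "j \<in> {1..l}" for j
      using that by blast
    then have "\<exists>j. j \<in> {1..l} \<and> x \<in> C j" using label_in[OF \<beta>] by blast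
    from someI_ex[OF this] this have "x \<in> C (\<gamma> x)" by (auto simp: \<gamma>_def Bex_def)
    then show False using x iff[OF \<gamma>_in] by auto
  qed
  have "measure \<mu> {x. \<beta> x \<noteq> \<gamma> x} \<le> measure \<mu> (\<Union>j\<in>{1..l}. ({x. \<beta> x = j} - C j) \<union> (C j - {x. \<beta> x = j}))"
    using sets by (intro finite_measure_mono sub) auto
  also have "\<dots> \<le> (\<Sum>j\<in>{1..l}. measure \<mu> (({x. \<beta> x = j} - C j) \<union> (C j - {x. \<beta> x = j})))"
    using sets by (intro finite_measure_subadditive_finite) auto
  also have "\<dots> < (\<Sum>j\<in>{1..l}. \<eta> / l)"
    using FC(4) \<open>1 \<le> l\<close> by (intro sum_strict_mono) auto
  also have "\<dots> = \<eta>" using \<open>1 \<le> l\<close> by simp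
  finally have "measure \<mu> {x. \<beta> x \<noteq> \<Phi> (pattern act E ?\<alpha> x)} < \<eta>"
    by (simp add: \<Phi>)
  moreover have "\<forall>\<phi>. \<Phi> \<phi> \<in> {1..l}" unfolding \<Phi>_def using \<gamma>_in by blast
  ultimately show ?thesis using E by blast
qed

end

lemma measure_uniform_count_Collect:
  "finite A \<Longrightarrow> measure (uniform_count_measure A) {v\<in>space (uniform_count_measure A). P v} =
    card {v\<in>A. P v} / card A"
  by (subst measure_uniform_count_measure) (auto simp: space_uniform_count_measure)

section \<open>Bowen's theorem\<close>

text \<open>A union bound over the finitely many pairs in \<open>P\<close>, each of which fails only
  on an asymptotically vanishing proportion of points. With \<open>P\<close> empty it merely records
  that \<open>d i\<close> is eventually positive.\<close>

lemma sofic_eventually_good: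
  assumes sofic: "sofic_approximation G d \<sigma>" and P: "finite P" "P \<subseteq> carrier G \<times> carrier G"
    and "0 < (\<tau>::real)"
  shows "\<forall>\<^sub>F i in sequentially. 0 < d i \<and> real (card {v\<in>{1..d i}. \<exists>(s, t)\<in>P.
    \<sigma> i s (\<sigma> i t v) \<noteq> \<sigma> i (s \<otimes>\<^bsub>G\<^esub> t) v}) \<le> \<tau> * d i"
proof -
  let ?bad = "\<lambda>i (s, t). {v\<in>{1..d i}. \<sigma> i s (\<sigma> i t v) \<noteq> \<sigma> i (s \<otimes>\<^bsub>G\<^esub> t) v}"
  \<comment> \<open>The \<open>+ 1\<close> keeps the denominator positive for empty
    \<open>P\<close>.\<close>
  let ?\<rho> = "\<tau> / (card P + 1)"
  have "?\<rho> > 0" using \<open>\<tau> > 0\<close> by simp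
  have pos: "\<forall>\<^sub>F i in sequentially. 0 < d i"
  proof -
    have "filterlim d at_top sequentially"
      using sofic unfolding sofic_approximation_def by (rule conjunct1)
    then have "\<forall>\<^sub>F i in sequentially. 1 \<le> d i"
      unfolding filterlim_at_top by (rule spec)
    then show ?thesis by eventually_elim simp
  qed
  have "\<forall>p\<in>P. \<forall>\<^sub>F i in sequentially. real (card (?bad i p)) \<le> ?\<rho> * d i"
  proof
    fix p assume "p \<in> P"
    then obtain s t where p: "p = (s, t)" "s \<in> carrier G" "t \<in> carrier G" using P by auto
    let ?good = "\<lambda>i. {v\<in>{1..d i}. \<sigma> i s (\<sigma> i t v) = \<sigma> i (s \<otimes>\<^bsub>G\<^esub> t) v}"
    have "(\<lambda>i. 1 / real (d i) * real (card (?good i))) \<longlonglongrightarrow> 1"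
      using sofic p by (simp add: sofic_approximation_def)
    then have "\<forall>\<^sub>F i in sequentially. 1 - ?\<rho> < 1 / real (d i) * real (card (?good i))"
      using \<open>?\<rho> > 0\<close> by (intro order_tendstoD) auto
    then show "\<forall>\<^sub>F i in sequentially. real (card (?bad i p)) \<le> ?\<rho> * d i"
      using pos
    proof eventually_elim
      case (elim i)
      have "card (?bad i p \<union> ?good i) = card (?bad i p) + card (?good i)"
        by (rule card_Un_disjoint) (auto simp: p)
      also have "?bad i p \<union> ?good i = {1..d i}" by (auto simp: p)
      finally have "real (d i) = real (card (?bad i p)) + real (card (?good i))" by simp
      moreover have "(1 - ?\<rho>) * d i < card (?good i)"
        using elim by (simp add: pos_less_divide_eq)
      ultimately show ?case by (simp add: algebra_simps)
    qed
  qed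
  then have "\<forall>\<^sub>F i in sequentially. \<forall>p\<in>P. real (card (?bad i p)) \<le> ?\<rho> * d i"
    using P(1) by (simp add: eventually_ball_finite_distrib)
  then show ?thesis
    using pos
  proof eventually_elim
    case (elim i)
    have "{v\<in>{1..d i}. \<exists>(s, t)\<in>P. \<sigma> i s (\<sigma> i t v) \<noteq> \<sigma> i (s \<otimes>\<^bsub>G\<^esub> t) v} = (\<Union>p\<in>P. ?bad i p)"
      by auto
    then have "real (card {v\<in>{1..d i}. \<exists>(s, t)\<in>P. \<sigma> i s (\<sigma> i t v) \<noteq> \<sigma> i (s \<otimes>\<^bsub>G\<^esub> t) v})
        \<le> real (\<Sum>p\<in>P. card (?bad i p))"
      using card_UN_le[OF P(1), of "?bad i"] by (simp only: of_nat_le_iff)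
    also have "\<dots> \<le> (\<Sum>p\<in>P. ?\<rho> * d i)"
      unfolding of_nat_sum using elim by (intro sum_mono) blast
    also have "\<dots> \<le> \<tau> * d i"
      using \<open>\<tau> > 0\<close> by (simp add: field_simps)
    finally show ?case using elim by simp
  qed
qed

text \<open>A factor \<open>exp (n * r)\<close> in cardinality costs \<open>r\<close> after
  normalisation. If \<open>card S = 0\<close>, the left side is minus infinity; otherwise
  \<open>card T\<close> is positive too and logarithms can be taken.\<close>

lemma log_card_le_add:
  assumes le: "real (card S) \<le> real (card T) * exp (n * r)" and "0 < (n::nat)"
  shows "ereal (1 / n) * log_card S \<le> ereal (1 / n) * log_card T + ereal r"
proof (cases "card S = 0")
  case True
  then show ?thesis using \<open>n > 0\<close> by (simp add: log_card_def)
next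
  case False
  then have T: "card T \<noteq> 0" using le by (intro notI) simp
  have "ln (card S) \<le> ln (card T * exp (n * r))"
    using le False T by (subst ln_le_cancel_iff) auto
  also have "\<dots> = ln (card T) + n * r"
    using T by (subst ln_mult_pos) auto
  finally have "1 / n * ln (card S) \<le> 1 / n * ln (card T) + r"
    using \<open>n > 0\<close> by (simp add: field_simps)
  then show ?thesis using False T by (simp add: log_card_def)
qed

context invariant_measure
begin

lemma neq_sets:
  fixes P Q :: "'x \<Rightarrow> 'c"
  assumes P: "P \<in> measurable borel (count_space S)" and Q: "Q \<in> measurable borel (count_space S')"
    and "finite S"
  shows "{x. P x \<noteq> Q x} \<in> sets borel"
proof -
  have "{x. P x \<noteq> Q x} = - (\<Union>c\<in>S. {x. P x \<in> {c}} \<inter> {x. Q x \<in> {c}})"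
    using label_in[OF P] by (simp add: set_eq_iff) metis
  also have "\<dots> \<in> sets borel"
    using \<open>finite S\<close>
    by (intro borel_comp sets.finite_UN sets.Int label_vimage_sets[OF P] label_vimage_sets[OF Q])
  finally show ?thesis .
qed

text \<open>The patterns of \<open>x\<close> differ only if the labels differ at
  \<open>act e x\<close> for some \<open>e\<close> in \<open>D\<close>. By invariance each of these
  \<open>card D\<close> events has measure at most \<open>\<eta>\<close>.\<close>

lemma measure_pattern_neq_le:
  fixes \<eta> :: real
  assumes \<beta>: "\<beta> \<in> measurable borel (count_space {1..l})" and \<gamma>: "\<gamma> \<in> measurable borel (count_space {1..l})"
    and D: "finite D" "D \<subseteq> carrier G" and \<eta>: "measure \<mu> {x. \<beta> x \<noteq> \<gamma> x} \<le> \<eta>"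
  shows "measure \<mu> {x. pattern act D \<beta> x \<noteq> pattern act D \<gamma> x} \<le> card D * \<eta>"
proof -
  let ?N = "{x. \<beta> x \<noteq> \<gamma> x}"
  have N: "?N \<in> sets borel"
    by (rule neq_sets[OF \<beta> \<gamma>]) simp
  have "measure \<mu> {x. pattern act D \<beta> x \<noteq> pattern act D \<gamma> x} \<le> measure \<mu> (\<Union>e\<in>D. act e -` ?N)"
  proof (rule finite_measure_mono)
    show "{x. pattern act D \<beta> x \<noteq> pattern act D \<gamma> x} \<subseteq> (\<Union>e\<in>D. act e -` ?N)"
      by (auto simp: pattern_def fun_eq_iff restrict_def split: if_splits)
    show "(\<Union>e\<in>D. act e -` ?N) \<in> sets \<mu>"
      unfolding sets_eq by (intro sets.finite_UN act_vimage_sets N D(1) subsetD[OF D(2)])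
  qed
  also have "\<dots> \<le> (\<Sum>e\<in>D. measure \<mu> (act e -` ?N))"
    unfolding sets_eq using act_vimage_sets[OF subsetD[OF D(2)] N]
    by (intro finite_measure_subadditive_finite D(1)) (auto simp: sets_eq)
  also have "\<dots> = (\<Sum>e\<in>D. measure \<mu> ?N)"
    by (intro sum.cong refl measure_act_vimage[OF subsetD[OF D(2)] N])
  also have "\<dots> \<le> card D * \<eta>"
    using \<eta> by (simp add: mult_left_mono)
  finally show ?thesis .
qed

text \<open>\<open>recode E F \<Phi>\<close> turns the \<open>\<alpha>\<close>-pattern of a point on \<open>window F E\<close> into the pattern on
  \<open>E\<close> of \<open>\<Phi>\<close> applied to the \<open>\<alpha>\<close>-pattern on \<open>F\<close>.\<close>

definition recode :: "'g set \<Rightarrow> 'g set \<Rightarrow> (('g \<Rightarrow> nat) \<Rightarrow> nat) \<Rightarrow> ('g \<Rightarrow> nat) \<Rightarrow> 'g \<Rightarrow> nat" where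
  "recode E F \<Phi> \<psi> = (\<lambda>e\<in>E. \<Phi> (\<lambda>f\<in>F. \<psi> (f \<otimes>\<^bsub>G\<^esub> e)))"

text \<open>The identity is adjoined so that a pattern on the window also shows the label of the
  point itself, with which a decoded label is to be compared.\<close>

definition window :: "'g set \<Rightarrow> 'g set \<Rightarrow> 'g set" where
  "window F E = insert \<one>\<^bsub>G\<^esub> ((\<lambda>(f, e). f \<otimes>\<^bsub>G\<^esub> e) ` (F \<times> E))"

lemma window: "finite F \<Longrightarrow> finite E \<Longrightarrow> finite (window F E)"
  "F \<subseteq> carrier G \<Longrightarrow> E \<subseteq> carrier G \<Longrightarrow> window F E \<subseteq> carrier G"
  "\<one>\<^bsub>G\<^esub> \<in> window F E"
  by (auto simp: window_def)

lemma mult_in_window: "f \<in> F \<Longrightarrow> e \<in> E \<Longrightarrow> f \<otimes>\<^bsub>G\<^esub> e \<in> window F E"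
  by (auto simp: window_def)

text \<open>Multiplicativity on \<open>F\<close> times \<open>E\<close> makes the label found by
  moving with \<open>e\<close> and then with \<open>f\<close> an entry of the pattern on the window.
  For the action this holds at every point, for a sofic approximation only at most points.\<close>

lemma pattern_recode:
  assumes "D \<subseteq> E" and "\<And>f e. f \<in> F \<Longrightarrow> e \<in> E \<Longrightarrow> s f (s e v) = s (f \<otimes>\<^bsub>G\<^esub> e) v"
  shows "pattern s D (\<lambda>w. \<Phi> (pattern s F a w)) v = recode D F \<Phi> (pattern s (window F E) a v)"
  using assms mult_in_window
  by (auto simp: pattern_def recode_def fun_eq_iff subset_eq intro!: arg_cong[where f=\<Phi>])

lemma recode_in: "(\<And>\<phi>. \<Phi> \<phi> \<in> {1..l}) \<Longrightarrow> recode E F \<Phi> \<psi> \<in> E \<rightarrow>\<^sub>E {1..l}"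
  by (auto simp: recode_def)

text \<open>Statistics of \<open>b\<close>: replacing \<open>\<beta>\<close> by its code on
  \<open>D\<close> costs \<open>2 * card D * \<eta>\<close>, passing to the finite model costs
  \<open>\<epsilon>\<close> because the coded pattern is a function of the window pattern, and the
  bad points cost \<open>2 * \<tau>\<close>. Decoding: failure is an event about window patterns
  whose \<open>\<mu>\<close>-measure is at most \<open>\<eta>' + card E * \<eta>\<close>; the model
  adds \<open>\<epsilon>\<close> and the bad points \<open>\<tau>\<close>.\<close>

lemma approx_labellings_recode:
  fixes \<alpha> \<beta> :: "'x \<Rightarrow> nat" and \<eta> \<eta>' \<epsilon> \<tau> :: real
  assumes \<alpha>: "\<alpha> \<in> measurable borel (count_space {1..k})" and \<beta>: "\<beta> \<in> measurable borel (count_space {1..l})"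
    and F: "finite F" "F \<subseteq> carrier G" and E: "finite E" "E \<subseteq> carrier G" and D: "D \<subseteq> E"
    and \<Phi>: "\<And>\<phi>. \<Phi> \<phi> \<in> {1..l}"
    and \<eta>: "measure \<mu> {x. \<beta> x \<noteq> \<Phi> (pattern act F \<alpha> x)} \<le> \<eta>"
    and \<eta>': "measure \<mu> {x. \<alpha> x \<noteq> \<Psi> (pattern act E \<beta> x)} \<le> \<eta>'"
    and s: "\<And>g. g \<in> carrier G \<Longrightarrow> s g permutes {1..n}" and "n > 0"
    and bad: "real (card {v\<in>{1..n}. \<not> (s \<one>\<^bsub>G\<^esub> v = v \<and>
        (\<forall>f\<in>F. \<forall>e\<in>E. s f (s e v) = s (f \<otimes>\<^bsub>G\<^esub> e) v))}) \<le> \<tau> * real n"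
    and a: "a \<in> approx_labellings act \<mu> n s k \<alpha> (window F E) \<epsilon>"
  defines "b \<equiv> \<lambda>v\<in>{1..n}. \<Phi> (pattern s F a v)"
  shows "b \<in> approx_labellings act \<mu> n s l \<beta> D (2 * card D * \<eta> + \<epsilon> + 2 * \<tau>)"
    and "real (card {v\<in>{1..n}. a v \<noteq> \<Psi> (pattern s E b v)}) \<le> (\<eta>' + card E * \<eta> + \<epsilon> + \<tau>) * real n"
proof -
  let ?K = "window F E" and ?U = "uniform_count_measure {1..n}"
  let ?S = "?K \<rightarrow>\<^sub>E {1..k}"
  let ?\<beta> = "\<lambda>x. \<Phi> (pattern act F \<alpha> x)"
  let ?good = "\<lambda>v. s \<one>\<^bsub>G\<^esub> v = v \<and> (\<forall>f\<in>F. \<forall>e\<in>E. s f (s e v) = s (f \<otimes>\<^bsub>G\<^esub> e) v)"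
  interpret U: prob_space ?U
    using \<open>n > 0\<close> by (intro prob_space_uniform_count_measure) auto
  have K: "finite ?K" "?K \<subseteq> carrier G" using window F E by auto
  have finD: "finite D" and DG: "D \<subseteq> carrier G" using E D by (auto intro: finite_subset)
  have finS: "finite ?S" using K by (simp add: finite_PiE)
  have finDl: "finite (D \<rightarrow>\<^sub>E {1..l})" using finD by (simp add: finite_PiE)
  have a': "a \<in> {1..n} \<rightarrow>\<^sub>E {1..k}"
    and aK: "law_dist ?S \<mu> (pattern act ?K \<alpha>) ?U (pattern s ?K a) \<le> \<epsilon>"
    using a by (auto simp: approx_labellings_def)
  have s_in: "s g v \<in> {1..n}" if "g \<in> carrier G" "v \<in> {1..n}" for g v
    using permutes_in_image[OF s] that by blast
  have b: "b \<in> {1..n} \<rightarrow>\<^sub>E {1..l}"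
    unfolding b_def using \<Phi> by auto
  have m\<alpha>K: "pattern act ?K \<alpha> \<in> measurable \<mu> (count_space ?S)"
    unfolding measurable_\<mu> by (rule measurable_pattern[OF \<alpha> K])
  have maK: "pattern s ?K a \<in> measurable ?U (count_space ?S)"
  proof (intro measurable_uniform_count_measure Pi_I pattern_in)
    fix v f assume "v \<in> {1..n}" "f \<in> ?K"
    then show "a (s f v) \<in> {1..k}" using K a' s_in by (intro PiE_mem[OF a']) blast
  qed
  have m\<beta>: "?\<beta> \<in> measurable borel (count_space {1..l})"
    using \<Phi> by (intro measurable_compose[OF measurable_pattern[OF \<alpha> F]]) auto
  have m\<beta>D: "pattern act D \<beta> \<in> measurable \<mu> (count_space (D \<rightarrow>\<^sub>E {1..l}))"
    unfolding measurable_\<mu> by (rule measurable_pattern[OF \<beta> finD DG])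
  have m\<gamma>D: "pattern act D ?\<beta> \<in> measurable \<mu> (count_space (D \<rightarrow>\<^sub>E {1..l}))"
    unfolding measurable_\<mu> by (rule measurable_pattern[OF m\<beta> finD DG])
  \<comment> \<open>The subset \<open>D'\<close> stays free: it will be \<open>D\<close> for the
    statistics of \<open>b\<close> and \<open>E\<close> for the decoding.\<close>
  have act_rec: "pattern act D' ?\<beta> x = recode D' F \<Phi> (pattern act ?K \<alpha> x)" if "D' \<subseteq> E" for D' x
    using that by (intro pattern_recode) (simp_all add: act_mult subsetD[OF F(2)] subsetD[OF E(2)])
  have b_rec: "pattern s D' b v = recode D' F \<Phi> (pattern s ?K a v)"
    if "D' \<subseteq> E" "v \<in> {1..n}" "?good v" for D' v
  proof -
    have "pattern s D' b v = pattern s D' (\<lambda>w. \<Phi> (pattern s F a w)) v"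
      using that E s_in by (auto simp: pattern_def b_def fun_eq_iff subset_eq restrict_def)
    also have "\<dots> = recode D' F \<Phi> (pattern s ?K a v)"
      using that by (intro pattern_recode) auto
    finally show ?thesis .
  qed
  have bad': "measure ?U {v\<in>space ?U. \<not> ?good v} \<le> \<tau>"
    using bad \<open>n > 0\<close> by (subst measure_uniform_count_Collect) (simp_all add: field_simps)
  have mrecK: "(\<lambda>v. recode D F \<Phi> (pattern s ?K a v)) \<in> measurable ?U (count_space (D \<rightarrow>\<^sub>E {1..l}))"
    using recode_in[OF \<Phi>] by (intro measurable_compose[OF maK]) auto
  have mbD: "pattern s D b \<in> measurable ?U (count_space (D \<rightarrow>\<^sub>E {1..l}))"
  proof (intro measurable_uniform_count_measure Pi_I pattern_in)
    fix v f assume "v \<in> {1..n}" "f \<in> D"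
    then show "b (s f v) \<in> {1..l}" using DG s_in by (intro PiE_mem[OF b]) blast
  qed
  let ?R = "D \<rightarrow>\<^sub>E {1..l}"
  have "law_dist ?R \<mu> (pattern act D \<beta>) ?U (pattern s D b) \<le>
      law_dist ?R \<mu> (pattern act D \<beta>) \<mu> (pattern act D ?\<beta>) +
      law_dist ?R \<mu> (pattern act D ?\<beta>) ?U (pattern s D b)"
    by (rule law_dist_triangle)
  also have "law_dist ?R \<mu> (pattern act D ?\<beta>) ?U (pattern s D b) \<le>
      law_dist ?R \<mu> (pattern act D ?\<beta>) ?U (\<lambda>v. recode D F \<Phi> (pattern s ?K a v)) +
      law_dist ?R ?U (\<lambda>v. recode D F \<Phi> (pattern s ?K a v)) ?U (pattern s D b)"
    by (rule law_dist_triangle)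
  also have "law_dist ?R \<mu> (pattern act D ?\<beta>) ?U (\<lambda>v. recode D F \<Phi> (pattern s ?K a v)) \<le>
      law_dist ?S \<mu> (pattern act ?K \<alpha>) ?U (pattern s ?K a)"
    unfolding act_rec[OF D]
    by (intro law_dist_comp_le finite_measure_axioms U.finite_measure_axioms m\<alpha>K maK finS finDl
        Pi_I recode_in \<Phi>)
  also have "\<dots> \<le> \<epsilon>" by (rule aK)
  also have "law_dist ?R \<mu> (pattern act D \<beta>) \<mu> (pattern act D ?\<beta>) \<le>
      2 * measure \<mu> {x\<in>space \<mu>. pattern act D \<beta> x \<noteq> pattern act D ?\<beta> x}"
    by (intro law_dist_le_disagreement m\<beta>D m\<gamma>D finDl finite_measure_axioms)
  also have "\<dots> \<le> 2 * (card D * \<eta>)"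
    using measure_pattern_neq_le[OF \<beta> m\<beta> finD DG \<eta>] by (simp add: space_eq)
  also have "law_dist ?R ?U (\<lambda>v. recode D F \<Phi> (pattern s ?K a v)) ?U (pattern s D b) \<le>
      2 * measure ?U {v\<in>space ?U. recode D F \<Phi> (pattern s ?K a v) \<noteq> pattern s D b v}"
    by (intro law_dist_le_disagreement mrecK mbD finDl U.finite_measure_axioms)
  also have "measure ?U {v\<in>space ?U. recode D F \<Phi> (pattern s ?K a v) \<noteq> pattern s D b v} \<le>
      measure ?U {v\<in>space ?U. \<not> ?good v}"
    using b_rec[OF D]
    by (intro U.finite_measure_mono) (auto simp: space_uniform_count_measure sets_uniform_count_measure)
  also have "\<dots> \<le> \<tau>" by (rule bad')
  finally have "law_dist ?R \<mu> (pattern act D \<beta>) ?U (pattern s D b) \<le> 2 * card D * \<eta> + \<epsilon> + 2 * \<tau>"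
    by (simp add: algebra_simps)
  then show "b \<in> approx_labellings act \<mu> n s l \<beta> D (2 * card D * \<eta> + \<epsilon> + 2 * \<tau>)"
    unfolding approx_labellings_def using b by simp
  \<comment> \<open>The window patterns from which encoding followed by decoding returns a wrong
    label at the identity.\<close>
  define T where "T = {\<psi>\<in>?S. \<psi> \<one>\<^bsub>G\<^esub> \<noteq> \<Psi> (recode E F \<Phi> \<psi>)}"
  have T: "T \<subseteq> ?S" by (auto simp: T_def)
  have \<psi>1: "pattern s' ?K c y \<one>\<^bsub>G\<^esub> = c (s' \<one>\<^bsub>G\<^esub> y)" for s' c and y :: 'z
    using window(3) by (simp add: pattern_def)
  have inT: "pattern act ?K \<alpha> x \<in> T \<longleftrightarrow> \<alpha> x \<noteq> \<Psi> (pattern act E ?\<beta> x)" for x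
    using measurable_space[OF m\<alpha>K, of x]
    by (auto simp: T_def act_rec \<psi>1 act_one space_eq)
  have "(\<lambda>x. \<Psi> (pattern act E \<beta> x)) \<in> measurable borel (count_space UNIV)"
    by (rule measurable_compose[OF measurable_pattern[OF \<beta> E]]) simp
  from neq_sets[OF \<alpha> this]
  have sets12: "{x. \<alpha> x \<noteq> \<Psi> (pattern act E \<beta> x)} \<in> sets \<mu>"
    "{x. pattern act E \<beta> x \<noteq> pattern act E ?\<beta> x} \<in> sets \<mu>"
    unfolding sets_eq
    using neq_sets[OF measurable_pattern[OF \<beta> E] measurable_pattern[OF m\<beta> E]] E
    by (auto simp: finite_PiE)
  have "measure ?U {v\<in>space ?U. a v \<noteq> \<Psi> (pattern s E b v)} \<le>
      measure ?U ({v\<in>space ?U. \<not> ?good v} \<union> {v\<in>space ?U. pattern s ?K a v \<in> T})"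
  proof (intro U.finite_measure_mono subsetI)
    fix v assume "v \<in> {v\<in>space ?U. a v \<noteq> \<Psi> (pattern s E b v)}"
    then have v: "v \<in> {1..n}" "a v \<noteq> \<Psi> (pattern s E b v)" "v \<in> space ?U"
      by (auto simp: space_uniform_count_measure)
    show "v \<in> {v\<in>space ?U. \<not> ?good v} \<union> {v\<in>space ?U. pattern s ?K a v \<in> T}"
    proof (cases "?good v")
      case True
      then have "pattern s ?K a v \<one>\<^bsub>G\<^esub> = a v"
        using window(3) by (simp add: pattern_def)
      then have "pattern s ?K a v \<in> T"
        using measurable_space[OF maK v(3)] v(2) b_rec[OF order_refl v(1) True] by (simp add: T_def)
      then show ?thesis using v by simp
    qed (use v in simp)
  qed (auto simp: sets_uniform_count_measure space_uniform_count_measure)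
  also have "\<dots> \<le> measure ?U {v\<in>space ?U. \<not> ?good v} + measure ?U {v\<in>space ?U. pattern s ?K a v \<in> T}"
    by (intro measure_Un_le) (auto simp: sets_uniform_count_measure space_uniform_count_measure)
  also have "\<dots> \<le> \<tau> + (\<epsilon> + measure \<mu> {x\<in>space \<mu>. pattern act ?K \<alpha> x \<in> T})"
    using bad' aK measure_diff_le_law_dist[OF finite_measure_axioms m\<alpha>K U.finite_measure_axioms maK finS T]
    by linarith
  also have "measure \<mu> {x\<in>space \<mu>. pattern act ?K \<alpha> x \<in> T} = measure \<mu> {x. \<alpha> x \<noteq> \<Psi> (pattern act E ?\<beta> x)}"
    by (simp add: inT space_eq)
  \<comment> \<open>The code \<open>\<Psi>\<close> was chosen for the true \<open>\<beta>\<close>,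
    but is fed with its approximation \<open>?\<beta>\<close>; it can fail only where it already
    fails for \<open>\<beta>\<close> or where the two patterns on \<open>E\<close> differ.\<close>
  also have "\<dots> \<le>
     measure \<mu> ({x. \<alpha> x \<noteq> \<Psi> (pattern act E \<beta> x)} \<union> {x. pattern act E \<beta> x \<noteq> pattern act E ?\<beta> x})"
    using sets12 by (intro finite_measure_mono) auto
  also have "\<dots> \<le> measure \<mu> {x. \<alpha> x \<noteq> \<Psi> (pattern act E \<beta> x)} +
      measure \<mu> {x. pattern act E \<beta> x \<noteq> pattern act E ?\<beta> x}"
    using sets12 by (intro measure_Un_le)
  also have "\<dots> \<le> \<eta>' + card E * \<eta>"
    using \<eta>' measure_pattern_neq_le[OF \<beta> m\<beta> E \<eta>] by linarith
  finally have "measure ?U {v\<in>space ?U. a v \<noteq> \<Psi> (pattern s E b v)} \<le> \<eta>' + card E * \<eta> + \<epsilon> + \<tau>"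
    by simp
  then show "real (card {v\<in>{1..n}. a v \<noteq> \<Psi> (pattern s E b v)}) \<le> (\<eta>' + card E * \<eta> + \<epsilon> + \<tau>) * real n"
    using \<open>n > 0\<close> by (subst (asm) measure_uniform_count_Collect) (simp_all add: field_simps)
qed

text \<open>Coding maps good labellings for \<open>A\<close> to good labellings for
  \<open>B\<close>, with fibres of size at most \<open>exp (d i * r)\<close>, so the entropy drops
  by at most \<open>r\<close>. Exchanging the two partitions gives the reverse inequality, hence
  Bowen's theorem.\<close>

lemma partition_entropy_le:
  assumes sofic: "sofic_approximation G d \<sigma>"
    and A: "borel_partition k A" "generating G act \<mu> k A"
    and B: "borel_partition l B" "generating G act \<mu> l B"
  shows "partition_entropy G act d \<sigma> \<mu> k A \<le> partition_entropy G act d \<sigma> \<mu> l B"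
proof -
  let ?\<alpha> = "part_label k A" and ?\<beta> = "part_label l B"
  note \<alpha> = borel_partition_label(3)[OF A(1)] and \<beta> = borel_partition_label(3)[OF B(1)]
  have perm: "\<sigma> i g permutes {1..d i}" if "g \<in> carrier G" for i g
    using sofic that by (simp add: sofic_approximation_def)
  have main: "partition_entropy G act d \<sigma> \<mu> k A \<le> entropy_at act d \<sigma> \<mu> l B D \<delta> + ereal r"
    if D: "finite D" "D \<noteq> {}" "D \<subseteq> carrier G" and "\<delta> > 0" "r > 0" for D \<delta> r
  proof -
    \<comment> \<open>The order of choices matters: \<open>\<kappa>\<close> depends on
      \<open>r\<close> and \<open>k\<close>, the decoder \<open>\<Psi>\<close> on
      \<open>\<kappa>\<close>, the errors \<open>\<eta>\<close>, \<open>\<epsilon>\<close>,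
      \<open>\<tau>\<close> on the window of \<open>\<Psi>\<close>, and only then is the encoder
      \<open>\<Phi>\<close> chosen.\<close>
    obtain \<kappa> where \<kappa>: "\<kappa> > 0" and ball: "\<And>n c. real (card {a \<in> {1..n} \<rightarrow>\<^sub>E {1..k}.
        real (card {v\<in>{1..n}. a v \<noteq> c v}) \<le> \<kappa> * real n}) \<le> exp (real n * r)"
      using exists_Hamming_radius[OF \<open>r > 0\<close>, of k] by blast
    \<comment> \<open>With \<open>D\<close> inside \<open>E\<close>, multiplicativity on
      \<open>F\<close> times \<open>E\<close> serves both the statistics on \<open>D\<close> and the
      decoding on \<open>E\<close>.\<close>
    obtain E \<Psi> where E: "finite E" "E \<subseteq> carrier G" "D \<subseteq> E"
      and \<Psi>: "measure \<mu> {x. ?\<alpha> x \<noteq> \<Psi> (pattern act E ?\<beta> x)} < \<kappa> / 4"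
      using generating_code[OF B \<alpha>, of "\<kappa> / 4" D] \<kappa> D by auto
    \<comment> \<open>Each of the four decoding errors gets a share \<open>\<kappa> / 4\<close>. For
      the statistics on \<open>D\<close>, the three losses get \<open>\<delta> / 2\<close>,
      \<open>\<delta> / 4\<close> and \<open>\<delta> / 4\<close>.\<close>
    define \<eta> where "\<eta> = min (\<kappa> / (4 * (card E + 1))) (\<delta> / (4 * (card D + 1)))"
    define \<epsilon> where "\<epsilon> = min (\<kappa> / 4) (\<delta> / 4)"
    define \<tau> where "\<tau> = min (\<kappa> / 4) (\<delta> / 8)"
    have pos: "\<eta> > 0" "\<epsilon> > 0" "\<tau> > 0" using \<kappa> \<open>\<delta> > 0\<close> by (auto simp: \<eta>_def \<epsilon>_def \<tau>_def)
    have "card E * \<eta> \<le> (card E + 1) * (\<kappa> / (4 * (card E + 1)))"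
      using pos by (intro mult_mono) (auto simp: \<eta>_def)
    also have "\<dots> = \<kappa> / 4" by (simp add: divide_simps)
    finally have E\<eta>: "\<kappa> / 4 + card E * \<eta> + \<epsilon> + \<tau> \<le> \<kappa>" by (simp add: \<epsilon>_def \<tau>_def)
    have "card D * \<eta> \<le> (card D + 1) * (\<delta> / (4 * (card D + 1)))"
      using pos by (intro mult_mono) (auto simp: \<eta>_def)
    also have "\<dots> = \<delta> / 4" by (simp add: divide_simps)
    finally have D\<eta>: "2 * card D * \<eta> + \<epsilon> + 2 * \<tau> \<le> \<delta>" by (simp add: \<epsilon>_def \<tau>_def)
    obtain F \<Phi> where F: "finite F" "F \<subseteq> carrier G" and \<Phi>: "\<And>\<phi>. \<Phi> \<phi> \<in> {1..l}"
      "measure \<mu> {x. ?\<beta> x \<noteq> \<Phi> (pattern act F ?\<alpha> x)} < \<eta>"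
      using generating_code[OF A \<beta> \<open>\<eta> > 0\<close>, of "{}"] by auto
    \<comment> \<open>The pair of identities controls the fixed points of the permutation at the
      identity: if applying it twice to \<open>v\<close> equals applying it once, injectivity shows
      that it fixes \<open>v\<close>.\<close>
    define P where "P = insert (\<one>\<^bsub>G\<^esub>, \<one>\<^bsub>G\<^esub>) (F \<times> E)"
    have P: "finite P" "P \<subseteq> carrier G \<times> carrier G" using E F by (auto simp: P_def)
    have W: "finite (window F E)" "window F E \<noteq> {}" "window F E \<subseteq> carrier G"
      using window(1)[OF F(1) E(1)] window(3)[of F E] window(2)[OF F(2) E(2)] by auto
    have "\<forall>\<^sub>F i in sequentially. ereal (1 / d i) * log_card (AP act \<mu> (d i) (\<sigma> i) k A (window F E) \<epsilon>) \<le>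
        ereal (1 / d i) * log_card (AP act \<mu> (d i) (\<sigma> i) l B D \<delta>) + ereal r"
      using sofic_eventually_good[OF sofic P \<open>\<tau> > 0\<close>]
    proof eventually_elim
      case (elim i)
      let ?n = "d i" and ?s = "\<sigma> i"
      let ?X = "approx_labellings act \<mu> ?n ?s k ?\<alpha> (window F E) \<epsilon>"
      let ?Y = "approx_labellings act \<mu> ?n ?s l ?\<beta> D \<delta>"
      let ?b = "\<lambda>a. \<lambda>v\<in>{1..?n}. \<Phi> (pattern ?s F a v)"
      let ?ball = "\<lambda>b. {a \<in> {1..?n} \<rightarrow>\<^sub>E {1..k}.
        real (card {v\<in>{1..?n}. a v \<noteq> \<Psi> (pattern ?s E b v)}) \<le> \<kappa> * real ?n}"
      have "{v\<in>{1..?n}. \<not> (?s \<one>\<^bsub>G\<^esub> v = v \<and> (\<forall>f\<in>F. \<forall>e\<in>E. ?s f (?s e v) = ?s (f \<otimes>\<^bsub>G\<^esub> e) v))} \<subseteq>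
          {v\<in>{1..?n}. \<exists>(s, t)\<in>P. ?s s (?s t v) \<noteq> ?s (s \<otimes>\<^bsub>G\<^esub> t) v}"
      proof safe
        fix v assume "v \<in> {1..?n}" and neq: "?s \<one>\<^bsub>G\<^esub> v \<noteq> v"
        have "?s \<one>\<^bsub>G\<^esub> (?s \<one>\<^bsub>G\<^esub> v) \<noteq> ?s (\<one>\<^bsub>G\<^esub> \<otimes>\<^bsub>G\<^esub> \<one>\<^bsub>G\<^esub>) v"
          using neq permutes_inj[OF perm[OF one_closed, of i]] by (simp add: inj_eq)
        then show "\<exists>(s, t)\<in>P. ?s s (?s t v) \<noteq> ?s (s \<otimes>\<^bsub>G\<^esub> t) v"
          by (auto simp: P_def)
      qed (auto simp: P_def)
      then have "real (card {v\<in>{1..?n}. \<not> (?s \<one>\<^bsub>G\<^esub> v = v \<and> (\<forall>f\<in>F. \<forall>e\<in>E. ?s f (?s e v) = ?s (f \<otimes>\<^bsub>G\<^esub> e) v))})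
          \<le> real (card {v\<in>{1..?n}. \<exists>(s, t)\<in>P. ?s s (?s t v) \<noteq> ?s (s \<otimes>\<^bsub>G\<^esub> t) v})"
        by (intro of_nat_mono card_mono) auto
      then have bad: "real (card {v\<in>{1..?n}. \<not> (?s \<one>\<^bsub>G\<^esub> v = v \<and>
          (\<forall>f\<in>F. \<forall>e\<in>E. ?s f (?s e v) = ?s (f \<otimes>\<^bsub>G\<^esub> e) v))}) \<le> \<tau> * real ?n"
        using elim by linarith
      note rec = approx_labellings_recode[OF \<alpha> \<beta> F E \<Phi>(1) less_imp_le[OF \<Phi>(2)] less_imp_le[OF \<Psi>]
          perm conjunct1[OF elim] bad]
      have fin: "finite ?Y"
        by (rule finite_subset[of _ "{1..?n} \<rightarrow>\<^sub>E {1..l}"]) (auto simp: approx_labellings_def finite_PiE)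
      \<comment> \<open>The centre of the ball around \<open>a\<close> is the decoding of
        \<open>?b a\<close>, so it depends on \<open>a\<close> only through its image in
        \<open>?Y\<close>.\<close>
      have "?X \<subseteq> (\<Union>b\<in>?Y. ?ball b)"
      proof
        fix a assume a: "a \<in> ?X"
        have "?b a \<in> ?Y"
          using rec(1)[OF _ a] D\<eta> by (auto simp: approx_labellings_def)
        moreover have "(\<kappa> / 4 + card E * \<eta> + \<epsilon> + \<tau>) * real ?n \<le> \<kappa> * real ?n"
          using E\<eta> by (intro mult_right_mono) auto
        then have "a \<in> ?ball (?b a)"
          using rec(2)[OF _ a] a by (auto simp: approx_labellings_def)
        ultimately show "a \<in> (\<Union>b\<in>?Y. ?ball b)" by blast
      qed
      then have "card ?X \<le> card (\<Union>b\<in>?Y. ?ball b)"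
        using fin by (intro card_mono) (auto simp: finite_PiE)
      also have "\<dots> \<le> (\<Sum>b\<in>?Y. card (?ball b))"
        by (rule card_UN_le[OF fin])
      finally have "real (card ?X) \<le> (\<Sum>b\<in>?Y. real (card (?ball b)))"
        by (simp flip: of_nat_sum)
      also have "\<dots> \<le> (\<Sum>b\<in>?Y. exp (real ?n * r))"
        by (intro sum_mono ball)
      also have "\<dots> = real (card ?Y) * exp (real ?n * r)"
        by simp
      finally have "real (card (AP act \<mu> (d i) (\<sigma> i) k A (window F E) \<epsilon>)) \<le>
          real (card (AP act \<mu> (d i) (\<sigma> i) l B D \<delta>)) * exp (real ?n * r)"
        using W D perm by (subst (1 2) card_AP_eq) (auto simp: A B space_eq)
      then show ?case
        using elim by (intro log_card_le_add) auto
    qed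
    then have "entropy_at act d \<sigma> \<mu> k A (window F E) \<epsilon> \<le>
        limsup (\<lambda>i. ereal (1 / d i) * log_card (AP act \<mu> (d i) (\<sigma> i) l B D \<delta>) + ereal r)"
      unfolding entropy_at_def by (rule Limsup_mono)
    also have "\<dots> = entropy_at act d \<sigma> \<mu> l B D \<delta> + ereal r"
      unfolding entropy_at_def by (intro Limsup_add_ereal_right) auto
    finally show ?thesis
      unfolding partition_entropy_def using W pos by (intro INF_lower2[of "window F E"] INF_lower2[of \<epsilon>]) auto
  qed
  show ?thesis
    unfolding partition_entropy_def[of G act d \<sigma> \<mu> l B]
  proof (intro INF_greatest)
    fix D \<delta> assume "D \<in> {F. finite F \<and> F \<noteq> {} \<and> F \<subseteq> carrier G}" "\<delta> \<in> {0::real<..}"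
    \<comment> \<open>The loss \<open>r\<close> was an arbitrary positive number and is now
      removed.\<close>
    then show "partition_entropy G act d \<sigma> \<mu> k A \<le> entropy_at act d \<sigma> \<mu> l B D \<delta>"
      by (intro ereal_le_epsilon2[rule_format, OF main]) auto
  qed
qed

end

section \<open>Well-definedness and range of the entropy\<close>

lemma log_card_mono: "S \<subseteq> T \<Longrightarrow> finite T \<Longrightarrow> log_card S \<le> log_card T"
  using card_mono[of T S] by (auto simp: log_card_def)

lemma finite_indexed_partitions: "finite (indexed_partitions k n)"
  by (rule finite_subset[of _ "{1..k} \<rightarrow>\<^sub>E Pow {1..n}"]) (auto simp: indexed_partitions_def finite_PiE)

context invariant_measure
begin

text \<open>Two applications of \<open>partition_entropy_le\<close> show that all generating
  partitions give the same value, so the description in \<open>sofic_entropy\<close> has a unique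
  solution.\<close>

lemma sofic_entropy_eq:
  assumes "sofic_approximation G d \<sigma>" and "borel_partition k A" "generating G act \<mu> k A"
  shows "sofic_entropy G act d \<sigma> \<mu> = partition_entropy G act d \<sigma> \<mu> k A"
  unfolding sofic_entropy_def using assms
  by (intro the_equality) (auto intro!: antisym partition_entropy_le)

text \<open>The logarithm of a positive cardinality is non-negative. A negative limit superior
  therefore forces the sets to be eventually empty.\<close>

lemma entropy_at_less_0:
  assumes sofic: "sofic_approximation G d \<sigma>" and less: "entropy_at act d \<sigma> \<mu> k A F \<epsilon> < 0"
  shows "entropy_at act d \<sigma> \<mu> k A F \<epsilon> = - \<infinity>"
proof -
  have "\<forall>\<^sub>F i in sequentially. 0 < d i"
    using sofic_eventually_good[OF sofic, of "{}" 1] by (auto elim: eventually_mono)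
  moreover have "\<forall>\<^sub>F i in sequentially. ereal (1 / real (d i)) * log_card (AP act \<mu> (d i) (\<sigma> i) k A F \<epsilon>) < 0"
    using less unfolding entropy_at_def by (rule Limsup_lessD)
  ultimately have "\<forall>\<^sub>F i in sequentially. ereal (1 / real (d i)) * log_card (AP act \<mu> (d i) (\<sigma> i) k A F \<epsilon>) \<le> - \<infinity>"
  proof eventually_elim
    case (elim i)
    have "card (AP act \<mu> (d i) (\<sigma> i) k A F \<epsilon>) = 0"
    proof (rule ccontr)
      assume c: "card (AP act \<mu> (d i) (\<sigma> i) k A F \<epsilon>) \<noteq> 0"
      then have "0 \<le> ln (real (card (AP act \<mu> (d i) (\<sigma> i) k A F \<epsilon>))) / real (d i)"
        by (intro divide_nonneg_nonneg ln_ge_zero) auto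
      moreover have "ln (real (card (AP act \<mu> (d i) (\<sigma> i) k A F \<epsilon>))) / real (d i) < 0"
        using elim(2) c by (simp add: log_card_def)
      ultimately show False by linarith
    qed
    then show ?case using elim by (simp add: log_card_def)
  qed
  then have "entropy_at act d \<sigma> \<mu> k A F \<epsilon> \<le> - \<infinity>"
    unfolding entropy_at_def by (rule Limsup_bounded)
  then show ?thesis by simp
qed

text \<open>There are only \<open>k ^ d i\<close> labellings, so already one window and one
  tolerance give the bound \<open>ln k\<close>.\<close>

lemma partition_entropy_less_infinity:
  assumes sofic: "sofic_approximation G d \<sigma>" and A: "borel_partition k A"
  shows "partition_entropy G act d \<sigma> \<mu> k A < \<infinity>"
proof -
  let ?F = "{\<one>\<^bsub>G\<^esub>}"
  have "part_label k A undefined \<in> {1..k}" by (rule borel_partition_label(1)[OF A])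
  then have k: "1 \<le> k" by auto
  have perm: "\<sigma> i g permutes {1..d i}" if "g \<in> carrier G" for i g
    using sofic that by (simp add: sofic_approximation_def)
  have "\<forall>\<^sub>F i in sequentially. 0 < d i"
    using sofic_eventually_good[OF sofic, of "{}" 1] by (auto elim: eventually_mono)
  then have "\<forall>\<^sub>F i in sequentially. ereal (1 / real (d i)) * log_card (AP act \<mu> (d i) (\<sigma> i) k A ?F 1) \<le> ereal (ln k)"
  proof eventually_elim
    case (elim i)
    have "card (AP act \<mu> (d i) (\<sigma> i) k A ?F 1) =
        card (approx_labellings act \<mu> (d i) (\<sigma> i) k (part_label k A) ?F 1)"
      by (rule card_AP_eq[OF A space_eq]) (blast, use perm one_closed in blast)
    also have "\<dots> \<le> card ({1..d i} \<rightarrow>\<^sub>E {1..k})"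
      by (auto simp: approx_labellings_def finite_PiE intro!: card_mono)
    also have "\<dots> = k ^ d i" by (simp add: card_PiE)
    finally have "real (card (AP act \<mu> (d i) (\<sigma> i) k A ?F 1)) \<le> real k ^ d i"
      by (simp flip: of_nat_power)
    \<comment> \<open>A one-point set has logarithmic cardinality 0, which puts the bound into the
      form of \<open>log_card_le_add\<close>.\<close>
    also have "\<dots> = real (card {()}) * exp (d i * ln k)"
      using k by (simp add: exp_of_nat_mult)
    finally have "ereal (1 / real (d i)) * log_card (AP act \<mu> (d i) (\<sigma> i) k A ?F 1) \<le>
        ereal (1 / real (d i)) * log_card {()} + ereal (ln k)"
      using elim by (rule log_card_le_add)
    then show ?case by (simp add: log_card_def)
  qed
  then have "entropy_at act d \<sigma> \<mu> k A ?F 1 \<le> ereal (ln k)"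
    unfolding entropy_at_def by (rule Limsup_bounded)
  then have "partition_entropy G act d \<sigma> \<mu> k A \<le> ereal (ln k)"
    unfolding partition_entropy_def by (intro INF_lower2[of ?F] INF_lower2[of 1]) auto
  then show ?thesis by (rule le_less_trans) simp
qed

text \<open>A negative infimum is witnessed by a negative \<open>entropy_at\<close>, which must be
  minus infinity.\<close>

lemma partition_entropy_range:
  assumes sofic: "sofic_approximation G d \<sigma>" and A: "borel_partition k A"
  shows "partition_entropy G act d \<sigma> \<mu> k A \<in> {0..<\<infinity>} \<union> {- \<infinity>}"
proof (cases "partition_entropy G act d \<sigma> \<mu> k A < 0")
  case True
  then obtain F \<epsilon> where F: "F \<in> {F. finite F \<and> F \<noteq> {} \<and> F \<subseteq> carrier G}" "\<epsilon> \<in> {0<..}"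
    and "entropy_at act d \<sigma> \<mu> k A F \<epsilon> < 0"
    by (auto simp: partition_entropy_def INF_less_iff)
  then have "entropy_at act d \<sigma> \<mu> k A F \<epsilon> = - \<infinity>"
    by (intro entropy_at_less_0[OF sofic])
  then have "partition_entropy G act d \<sigma> \<mu> k A \<le> - \<infinity>"
    unfolding partition_entropy_def using F by (intro INF_lower2[of F] INF_lower2[of \<epsilon>]) auto
  then show ?thesis by simp
next
  case False
  then show ?thesis using partition_entropy_less_infinity[OF assms] by auto
qed

end

section \<open>Expansive actions and upper semi-continuity\<close>

text \<open>The pairs at distance at least \<open>\<epsilon>\<close> form a compact subset of the
  product, covered by the open sets of pairs that some \<open>g\<close> separates by more than
  \<open>\<delta>\<close>. A finite subcover gives \<open>F\<close>.\<close>

lemma expansive_uniform: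
  fixes act :: "'g \<Rightarrow> 'x::metric_space \<Rightarrow> 'x"
  assumes compact: "compact (UNIV :: 'x set)" and action: "continuous_action G act"
    and \<delta>: "\<And>x y. x \<noteq> y \<Longrightarrow> \<exists>g\<in>carrier G. dist (act g x) (act g y) > \<delta>"
    and "\<epsilon> > 0"
  shows "\<exists>F. finite F \<and> F \<subseteq> carrier G \<and> (\<forall>x y. (\<forall>f\<in>F. dist (act f x) (act f y) \<le> \<delta>) \<longrightarrow> dist x y < \<epsilon>)"
proof -
  let ?K = "{p :: 'x \<times> 'x. \<epsilon> \<le> dist (fst p) (snd p)}"
  let ?U = "\<lambda>g. {p :: 'x \<times> 'x. \<delta> < dist (act g (fst p)) (act g (snd p))}"
  have "closed ?K"
    by (intro closed_Collect_le continuous_intros)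
  moreover have "compact (UNIV :: ('x \<times> 'x) set)"
    using compact_Times[OF compact compact] by simp
  ultimately have K: "compact ?K"
    using compact_Int_closed[of UNIV ?K] by simp
  have op: "open (?U g)" if "g \<in> carrier G" for g
  proof -
    have "continuous_on UNIV (act g)" using action that by (simp add: continuous_action_def)
    then have "continuous_on UNIV (\<lambda>p. act g (fst p))" "continuous_on UNIV (\<lambda>p. act g (snd p))"
      by (auto intro!: continuous_on_compose2[of UNIV "act g"] continuous_intros)
    then show ?thesis by (intro open_Collect_less continuous_intros)
  qed
  have cov: "?K \<subseteq> (\<Union>g\<in>carrier G. ?U g)"
  proof
    fix p assume "p \<in> ?K"
    then have "fst p \<noteq> snd p" using \<open>\<epsilon> > 0\<close> by auto
    then show "p \<in> (\<Union>g\<in>carrier G. ?U g)" using \<delta> by simp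
  qed
  obtain F where F: "F \<subseteq> carrier G" "finite F" "?K \<subseteq> (\<Union>g\<in>F. ?U g)"
    using compactE_image[OF K op cov] by blast
  have "dist x y < \<epsilon>" if "\<forall>f\<in>F. dist (act f x) (act f y) \<le> \<delta>" for x y
  proof (rule ccontr)
    assume "\<not> dist x y < \<epsilon>"
    then have "(x, y) \<in> ?K" by simp
    from subsetD[OF F(3) this] obtain g where "g \<in> F" "\<delta> < dist (act g x) (act g y)" by auto
    then show False using that by fastforce
  qed
  then show ?thesis using F by blast
qed

text \<open>Points with equal patterns stay within \<open>\<delta>\<close> along the window, hence
  by \<open>expansive_uniform\<close> are close to each other for large windows. So every open set
  is a countable union of cylinders, and any invariant \<sigma>-algebra containing the blocks
  contains all Borel sets.\<close>

lemma expansive_generating: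
  fixes act :: "'g \<Rightarrow> 'x::metric_space \<Rightarrow> 'x"
  assumes "invariant_measure G act \<mu>" and compact: "compact (UNIV :: 'x set)"
    and \<delta>: "\<And>x y. x \<noteq> y \<Longrightarrow> \<exists>g\<in>carrier G. dist (act g x) (act g y) > \<delta>"
    and A: "borel_partition k A" and diam: "\<And>j x y. j \<in> {1..k} \<Longrightarrow> x \<in> A j \<Longrightarrow> y \<in> A j \<Longrightarrow> dist x y \<le> \<delta>"
  shows "generating G act \<mu> k A"
proof -
  interpret invariant_measure G act \<mu> by fact
  let ?\<alpha> = "part_label k A"
  note \<alpha> = borel_partition_label[OF A]
  have "sets borel \<subseteq> invariant_sigma_algebra G act k A"
    unfolding invariant_sigma_algebra_def
  proof (intro Inter_greatest, elim CollectE conjE)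
    fix S assume S: "sigma_algebra UNIV S" and img: "\<forall>g\<in>carrier G. \<forall>C\<in>S. act g ` C \<in> S"
      and AS: "A ` {1..k} \<subseteq> S"
    interpret S: sigma_algebra UNIV S by fact
    have vimage: "act g -` C \<in> S" if "g \<in> carrier G" "C \<in> S" for g C
    proof -
      have "act g -` C = act (inv\<^bsub>G\<^esub> g) ` C"
      proof (intro equalityI subsetI)
        fix x assume "x \<in> act g -` C"
        then show "x \<in> act (inv\<^bsub>G\<^esub> g) ` C"
          using act_inv(1)[OF that(1), of x] by (intro image_eqI[of _ _ "act g x"]) auto
      qed (auto simp: act_inv[OF that(1)])
      then show ?thesis using img that by simp
    qed
    have cyl: "C \<in> S" if F: "finite F" "F \<subseteq> carrier G" and C: "cylinder F ?\<alpha> C" for F C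
    proof -
      let ?P = "pattern act F ?\<alpha>"
      have in_PiE: "?P x \<in> F \<rightarrow>\<^sub>E {1..k}" for x
        by (rule pattern_in) (rule \<alpha>(1))
      have cell: "?P -` {?P x} \<in> S" for x
      \<comment> \<open>Closure under finite intersections is available only for a non-empty index
        set.\<close>
      proof (cases "F = {}")
        case True
        then have "?P -` {?P x} = UNIV" by (auto simp: pattern_def restrict_def)
        then show ?thesis using S.top by simp
      next
        case False
        have "?P -` {?P x} = {y. \<forall>f\<in>F. ?\<alpha> (act f y) = ?P x f}"
          by (auto simp: pattern_eq_iff[OF in_PiE])
        also have "\<dots> = (\<Inter>f\<in>F. act f -` A (?P x f))"
          using \<alpha>(2)[OF PiE_mem[OF in_PiE]] by auto
        also have "\<dots> \<in> S"
          using F False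
          by (intro S.finite_INT vimage subsetD[OF AS] imageI PiE_mem[OF in_PiE]) auto
        finally show ?thesis .
      qed
      have "finite (?P ` C)"
        using in_PiE F by (intro finite_subset[of "?P ` C" "F \<rightarrow>\<^sub>E {1..k}"]) (auto simp: finite_PiE)
      moreover have "(\<Union>\<phi>\<in>?P ` C. ?P -` {\<phi>}) = C"
        using cylinderD[OF C] by blast
      ultimately show ?thesis
        using S.finite_UN[of "?P ` C" "\<lambda>\<phi>. ?P -` {\<phi>}"] cell by auto
    qed
    have "U \<in> S" if "open U" for U
    proof -
      have "\<forall>n. \<exists>F. finite F \<and> F \<subseteq> carrier G \<and>
          (\<forall>x y. (\<forall>f\<in>F. dist (act f x) (act f y) \<le> \<delta>) \<longrightarrow> dist x y < 1 / Suc n)"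
        using expansive_uniform[OF compact action \<delta>] by (intro allI) simp
      then obtain F where F: "\<And>n. finite (F n)" "\<And>n. F n \<subseteq> carrier G"
        "\<And>n x y. (\<forall>f\<in>F n. dist (act f x) (act f y) \<le> \<delta>) \<Longrightarrow> dist x y < 1 / Suc n"
        by metis
      \<comment> \<open>The largest cylinder over the window \<open>F n\<close> contained in
        \<open>U\<close>.\<close>
      define C where "C n = {x. \<forall>y. pattern act (F n) ?\<alpha> y = pattern act (F n) ?\<alpha> x \<longrightarrow> y \<in> U}" for n
      have "C n \<in> S" for n
        using F by (intro cyl[of "F n"]) (auto simp: C_def cylinder_def)
      moreover have "(\<Union>n. C n) = U"
      proof (intro equalityI subsetI)
        fix x assume "x \<in> U"
        then obtain e where e: "e > 0" "ball x e \<subseteq> U" using \<open>open U\<close> open_contains_ball by blast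
        then obtain n where n: "1 / Suc n < e" using nat_approx_posE by auto
        have "y \<in> U" if eq: "pattern act (F n) ?\<alpha> y = pattern act (F n) ?\<alpha> x" for y
        proof -
          have "dist (act f x) (act f y) \<le> \<delta>" if f: "f \<in> F n" for f
          proof -
            have "?\<alpha> (act f y) = ?\<alpha> (act f x)"
              using fun_cong[OF eq, of f] f by (simp add: pattern_def)
            then show ?thesis
              using \<alpha>(2)[OF \<alpha>(1)] diam[OF \<alpha>(1)] by metis
          qed
          then have "dist x y < e" using F(3)[of n x y] n by fastforce
          then show ?thesis using e by auto
        qed
        then show "x \<in> (\<Union>n. C n)" by (auto simp: C_def)
      qed (auto simp: C_def)
      ultimately show ?thesis using S.countable_nat_UN[of C] by auto
    qed
    then show "sets borel \<subseteq> S"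
      unfolding borel_def by (subst sets_measure_of) (auto intro!: S.sigma_sets_subset)
  qed
  \<comment> \<open>Every Borel set is its own approximation, with empty symmetric
    difference.\<close>
  then show ?thesis
    unfolding generating_def by (intro ballI bexI[where P="\<lambda>C. _ C = _"]) auto
qed

section \<open>Continuity sets and weak star neighbourhoods\<close>

definition continuity_set :: "'x::topological_space measure \<Rightarrow> 'x set \<Rightarrow> bool" where
  "continuity_set \<mu> C \<longleftrightarrow> C \<in> sets borel \<and> measure \<mu> (frontier C) = 0"

lemma continuity_set_subset_UN:
  assumes "finite_measure \<mu>" "sets \<mu> = sets borel" "C \<in> sets borel" "finite I"
    and "\<And>i. i \<in> I \<Longrightarrow> continuity_set \<mu> (B i)" "frontier C \<subseteq> (\<Union>i\<in>I. frontier (B i))"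
  shows "continuity_set \<mu> C"
proof -
  interpret finite_measure \<mu> by fact
  have "measure \<mu> (frontier C) \<le> measure \<mu> (\<Union>i\<in>I. frontier (B i))"
    using assms by (intro finite_measure_mono) auto
  also have "\<dots> \<le> (\<Sum>i\<in>I. measure \<mu> (frontier (B i)))"
    using assms by (intro finite_measure_subadditive_finite) auto
  also have "\<dots> = 0" using assms by (auto simp: continuity_set_def)
  finally show ?thesis using assms by (simp add: continuity_set_def measure_le_0_iff)
qed

lemma continuity_set_Compl: "continuity_set \<mu> C \<Longrightarrow> continuity_set \<mu> (- C)"
  by (simp add: continuity_set_def borel_comp)

lemma frontier_finite_Inter_subset:
  "finite I \<Longrightarrow> frontier (\<Inter>i\<in>I. B i) \<subseteq> (\<Union>i\<in>I. frontier (B i))"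
proof (induction I rule: finite_induct)
  case (insert i I)
  then show ?case using frontier_Int_subset[of "B i" "\<Inter>i\<in>I. B i"] by auto
qed simp

lemma continuity_set_finite_Inter:
  assumes "finite_measure \<mu>" "sets \<mu> = sets borel" "finite I"
    and "\<And>i. i \<in> I \<Longrightarrow> continuity_set \<mu> (B i)"
  shows "continuity_set \<mu> (\<Inter>i\<in>I. B i)"
proof (rule continuity_set_subset_UN[OF assms(1,2) _ assms(3,4) frontier_finite_Inter_subset[OF assms(3)]])
  show "(\<Inter>i\<in>I. B i) \<in> sets borel"
    using assms(3,4) by (cases "I = {}") (auto simp: continuity_set_def)
qed

text \<open>By continuity the frontier of the preimage lies in the preimage of the frontier, which
  is null by invariance.\<close>

lemma (in invariant_measure) continuity_set_act_vimage:
  assumes "g \<in> carrier G" "continuity_set \<mu> C"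
  shows "continuity_set \<mu> (act g -` C)"
proof -
  have cont: "continuous_on UNIV (act g)" using action assms by (simp add: continuous_action_def)
  have "closure (act g -` C) \<subseteq> act g -` closure C"
    using cont by (intro closure_minimal closed_vimage) (auto intro: subsetD[OF closure_subset])
  moreover have "act g -` interior C \<subseteq> interior (act g -` C)"
    using cont by (intro interior_maximal open_vimage) (auto intro: subsetD[OF interior_subset])
  ultimately have "measure \<mu> (frontier (act g -` C)) \<le> measure \<mu> (act g -` frontier C)"
    using act_vimage_sets[OF assms(1), of "frontier C"]
    by (intro finite_measure_mono) (auto simp: frontier_def sets_eq)
  then show ?thesis
    using assms act_vimage_sets by (auto simp: continuity_set_def measure_act_vimage measure_le_0_iff)
qed

text \<open>The push-forward of \<open>\<mu>\<close> under the distance from \<open>x\<close> has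
  only countably many atoms, so some radius in the uncountable interval is not an atom. The frontier
  of the ball lies in the sphere of that radius.\<close>

lemma exists_continuity_ball:
  fixes x :: "'x::metric_space"
  assumes "finite_measure \<mu>" "sets \<mu> = sets borel" "\<delta> > 0"
  shows "\<exists>r. 0 < r \<and> r < \<delta> \<and> continuity_set \<mu> (ball x r)"
proof -
  interpret finite_measure \<mu> by fact
  have m: "dist x \<in> measurable \<mu> borel"
    using assms(2) by (subst measurable_cong_sets[of \<mu> borel borel borel])
      (auto intro!: borel_measurable_continuous_onI continuous_intros)
  interpret N: finite_measure "distr \<mu> borel (dist x)"
    using m by (rule finite_measure_distr)
  have "uncountable {0<..<\<delta>}" using \<open>\<delta> > 0\<close> by (simp add: uncountable_open_interval)
  then obtain r where r: "r \<in> {0<..<\<delta>}" "measure (distr \<mu> borel (dist x)) {r} = 0"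
    using N.countable_support countable_subset[of "{0<..<\<delta>}"] by (smt (verit) mem_Collect_eq subsetI)
  have sphere: "closed {y. dist x y = r}"
    by (intro closed_Collect_eq continuous_intros)
  have "measure \<mu> {y. dist x y = r} = 0"
    using r m sets_eq_imp_space_eq[OF assms(2)] by (simp add: measure_distr vimage_def)
  moreover have "frontier (ball x r) \<subseteq> {y. dist x y = r}"
    using closure_minimal[OF ball_subset_cball closed_cball, of x r] by (auto simp: frontier_def interior_open)
  then have "measure \<mu> (frontier (ball x r)) \<le> measure \<mu> {y. dist x y = r}"
    using sphere assms(2) by (intro finite_measure_mono) auto
  ultimately show ?thesis using r by (auto simp: continuity_set_def measure_le_0_iff)
qed

text \<open>Compactness gives a finite cover by continuity balls of radius below
  \<open>\<delta> / 2\<close>. Making the cover disjoint uses only complements and finite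
  intersections, which preserve continuity sets.\<close>

lemma exists_continuity_partition:
  fixes \<mu> :: "'x::metric_space measure"
  assumes \<mu>: "finite_measure \<mu>" "sets \<mu> = sets borel" and compact: "compact (UNIV :: 'x set)"
    and "\<delta> > 0"
  shows "\<exists>k A. borel_partition k A \<and> (\<forall>j\<in>{1..k}. continuity_set \<mu> (A j) \<and> (\<forall>x\<in>A j. \<forall>y\<in>A j. dist x y \<le> \<delta>))"
proof -
  have "\<forall>x. \<exists>r. 0 < r \<and> r < \<delta> / 2 \<and> continuity_set \<mu> (ball x r)"
    by (intro allI exists_continuity_ball[OF \<mu>]) (simp add: \<open>\<delta> > 0\<close>)
  then obtain r where r: "\<And>x. 0 < r x" "\<And>x. r x < \<delta> / 2" "\<And>x. continuity_set \<mu> (ball x (r x))"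
    by metis
  have cov: "UNIV \<subseteq> (\<Union>x\<in>UNIV. ball x (r x))"
  proof
    fix x show "x \<in> (\<Union>x\<in>UNIV. ball x (r x))" using r(1)[of x] by (intro UN_I[of x]) auto
  qed
  obtain X where X: "finite X" "UNIV \<subseteq> (\<Union>x\<in>X. ball x (r x))"
    by (rule compactE_image[OF compact _ cov]) auto
  obtain h where h: "bij_betw h {1..card X} X" using ex_bij_betw_nat_finite_1[OF X(1)] by blast
  \<comment> \<open>\<open>disjointed\<close> works with sequences indexed from 0, whereas blocks
    are numbered from 1; the index 0 and those past \<open>card X\<close> get empty sets.\<close>
  define B where "B j = (if j \<in> {1..card X} then ball (h j) (r (h j)) else {})" for j
  have cB: "continuity_set \<mu> (B j)" for j
    using r(3) by (auto simp: B_def continuity_set_def)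
  have cA: "continuity_set \<mu> (disjointed B j)" for j
  proof -
    have "disjointed B j = (\<Inter>i\<in>{0..j}. if i = j then B j else - B i)"
      by (auto simp: disjointed_def split: if_splits)
    also have "continuity_set \<mu> \<dots>"
      using cB by (intro continuity_set_finite_Inter \<mu>) (auto intro: continuity_set_Compl)
    finally show ?thesis .
  qed
  have "(\<Union>j\<in>{1..card X}. disjointed B j) = UNIV"
  proof -
    have "x \<in> (\<Union>j\<in>{1..card X}. disjointed B j)" for x
    proof -
      have "(\<Union>j\<in>{1..card X}. ball (h j) (r (h j))) = (\<Union>x\<in>h ` {1..card X}. ball x (r x))" by blast
      also have "h ` {1..card X} = X" using h by (simp add: bij_betw_def)
      finally obtain i where "i \<in> {1..card X}" "x \<in> ball (h i) (r (h i))"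
        using X(2) by blast
      then have "x \<in> B i" by (simp add: B_def)
      then have "x \<in> (\<Union>j. B j)" by blast
      then obtain j where j: "x \<in> disjointed B j"
        unfolding UN_disjointed_eq[of B, symmetric] by (rule UN_E)
      from subsetD[OF disjointed_subset j] have "j \<in> {1..card X}"
        by (cases "j \<in> {1..card X}") (auto simp: B_def)
      with j show ?thesis by (intro UN_I)
    qed
    then show ?thesis by blast
  qed
  moreover have "disjoint_family_on (disjointed B) {1..card X}"
    using disjoint_family_disjointed[of B] by (auto simp: disjoint_family_on_def)
  ultimately have "borel_partition (card X) (disjointed B)"
    using cA by (auto simp: borel_partition_def continuity_set_def)
  moreover have "dist x y \<le> \<delta>" if "j \<in> {1..card X}" "x \<in> disjointed B j" "y \<in> disjointed B j" for j x y
  proof -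
    have "x \<in> B j" "y \<in> B j" using that disjointed_subset[of B j] by auto
    then have "dist (h j) x < \<delta> / 2" "dist (h j) y < \<delta> / 2"
      using r(2)[of "h j"] by (auto simp: B_def split: if_splits)
    then show ?thesis using dist_triangle_half_r[of "h j" x \<delta> y] by simp
  qed
  ultimately show ?thesis using cA by blast
qed

text \<open>One half of the portmanteau theorem. Continuous functions above the indicator of
  \<open>C\<close> decrease to that of its closure; one of them has \<open>\<mu>\<close>-integral
  below the bound, and its integral also dominates \<open>measure \<nu> C\<close>.\<close>

lemma weak_star_upper_neighbourhood:
  fixes C :: "'x::metric_space set"
  assumes \<mu>: "\<mu> \<in> borel_prob_measures" and C: "C \<in> sets borel" and "e > 0"
  shows "\<exists>U. openin weak_star_topology U \<and> \<mu> \<in> U \<and> (\<forall>\<nu>\<in>U. measure \<nu> C < measure \<mu> (closure C) + e)"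
\<comment> \<open>\<open>infdist\<close> to the empty set is 0 by convention, so the functions below
  would not tend to the right limit.\<close>
proof (cases "C = {}")
  case True
  then show ?thesis
    using \<mu> \<open>e > 0\<close> openin_topspace[of "weak_star_topology :: 'x measure topology"]
    by (intro exI[of _ borel_prob_measures]) (auto simp: topspace_weak_star_topology)
next
  case False
  define f where "f n x = max 0 (1 - real n * infdist x C)" for n x
  have cont: "continuous_on UNIV (f n)" for n
    unfolding f_def by (intro continuous_intros)
  have f01: "0 \<le> f n x" "f n x \<le> 1" for n x
    by (auto simp: f_def infdist_nonneg)
  have int: "integrable \<nu> (f n)" if "\<nu> \<in> borel_prob_measures" for \<nu> n
  proof -
    interpret prob_space \<nu> using that by (simp add: borel_prob_measures_def)
    have "f n \<in> borel_measurable \<nu>"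
      using that borel_measurable_continuous_onI[OF cont]
      by (subst measurable_cong_sets[of \<nu> borel borel borel]) (auto simp: borel_prob_measures_def)
    then show ?thesis using f01 by (intro integrable_const_bound[of _ 1]) auto
  qed
  interpret prob_space \<mu> using \<mu> by (simp add: borel_prob_measures_def)
  have "(\<lambda>n. f n x) \<longlonglongrightarrow> indicator (closure C) x" for x
  proof (cases "x \<in> closure C")
    case True
    then have "infdist x C = 0" using False in_closure_iff_infdist_zero by blast
    then show ?thesis using True by (simp add: f_def)
  next
    case nx: False
    then have pos: "infdist x C > 0"
      using False in_closure_iff_infdist_zero[of C x] infdist_nonneg[of x C] by linarith
    then obtain N where N: "1 / infdist x C < real N" using reals_Archimedean2 by blast
    have "f n x = 0" if "n \<ge> N" for n
    proof -
      have "1 < real N * infdist x C" using N pos by (simp add: field_simps)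
      also have "\<dots> \<le> real n * infdist x C" using that pos by (intro mult_right_mono) auto
      finally show ?thesis by (simp add: f_def)
    qed
    then have "\<forall>\<^sub>F n in sequentially. f n x = 0" by (auto simp: eventually_sequentially)
    then show ?thesis using nx by (simp add: tendsto_eventually)
  qed
  moreover have "(indicator (closure C) :: 'x \<Rightarrow> real) \<in> borel_measurable \<mu>"
    using \<mu> by (intro borel_measurable_indicator) (simp add: borel_prob_measures_def)
  ultimately have "(\<lambda>n. \<integral>x. f n x \<partial>\<mu>) \<longlonglongrightarrow> (\<integral>x. indicator (closure C) x \<partial>\<mu>)"
    using int[OF \<mu>] f01
    by (intro integral_dominated_convergence[where w="\<lambda>_. 1"]) auto
  also have "(\<integral>x. indicator (closure C) x \<partial>\<mu>) = measure \<mu> (closure C)"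
    using \<mu> by (simp add: borel_prob_measures_def Int_absorb2 sets.sets_into_space)
  finally have "\<forall>\<^sub>F n in sequentially. (\<integral>x. f n x \<partial>\<mu>) < measure \<mu> (closure C) + e"
    using \<open>e > 0\<close> by (intro order_tendstoD) auto
  then obtain n where n: "(\<integral>x. f n x \<partial>\<mu>) < measure \<mu> (closure C) + e"
    by (auto simp: eventually_sequentially)
  let ?U = "{\<nu> \<in> borel_prob_measures. (\<integral>x. f n x \<partial>\<nu>) \<in> {..<measure \<mu> (closure C) + e}}"
  have "openin weak_star_topology ?U"
    unfolding weak_star_topology_def using cont open_lessThan
    by (intro topology_generated_by_Basis) blast
  moreover have "measure \<nu> C < measure \<mu> (closure C) + e" if "\<nu> \<in> ?U" for \<nu>
  proof -
    have \<nu>: "\<nu> \<in> borel_prob_measures" "sets \<nu> = sets borel"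
      using that by (auto simp: borel_prob_measures_def)
    interpret N: prob_space \<nu> using \<nu> by (simp add: borel_prob_measures_def)
    have "measure \<nu> C = (\<integral>x. indicator C x \<partial>\<nu>)"
      using C \<nu> by (simp add: Int_absorb2 sets.sets_into_space)
    also have "\<dots> \<le> (\<integral>x. f n x \<partial>\<nu>)"
    proof (intro integral_mono int[OF \<nu>(1)])
      show "integrable \<nu> (indicator C :: 'x \<Rightarrow> real)"
        using C \<nu>(2) by (intro integrable_real_indicator) (auto simp: less_top[symmetric])
      show "indicator C x \<le> f n x" for x by (auto simp: f_def indicator_def)
    qed
    finally show ?thesis using that by simp
  qed
  ultimately show ?thesis using n \<mu> by blast
qed

text \<open>The upper estimate is applied to \<open>C\<close> and to its complement, both of which
  have the measure of their closures; the complement supplies the lower estimate for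
  \<open>C\<close>.\<close>

lemma weak_star_continuity_neighbourhood:
  fixes C :: "'x::metric_space set"
  assumes \<mu>: "\<mu> \<in> borel_prob_measures" and C: "continuity_set \<mu> C" and "e > 0"
  shows "\<exists>U. openin weak_star_topology U \<and> \<mu> \<in> U \<and> (\<forall>\<nu>\<in>U. \<bar>measure \<mu> C - measure \<nu> C\<bar> < e)"
proof -
  have closure: "measure \<mu> (closure D) = measure \<mu> D" if "continuity_set \<mu> D" for D
  proof -
    interpret prob_space \<mu> using \<mu> by (simp add: borel_prob_measures_def)
    have s: "sets \<mu> = sets borel" using \<mu> by (simp add: borel_prob_measures_def)
    have "measure \<mu> (closure D) = measure \<mu> (D \<union> frontier D)"
      by (simp only: closure_Un_frontier)
    also have "\<dots> \<le> measure \<mu> D + measure \<mu> (frontier D)"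
      using that s by (intro measure_Un_le) (auto simp: continuity_set_def)
    finally have "measure \<mu> (closure D) \<le> measure \<mu> D" using that by (simp add: continuity_set_def)
    moreover have "measure \<mu> D \<le> measure \<mu> (closure D)"
      using s by (intro finite_measure_mono closure_subset) auto
    ultimately show ?thesis by simp
  qed
  note C' = continuity_set_Compl[OF C]
  have sets: "C \<in> sets borel" "- C \<in> sets borel" using C C' by (auto simp: continuity_set_def)
  obtain U where U: "openin weak_star_topology U" "\<mu> \<in> U" "\<And>\<nu>. \<nu> \<in> U \<Longrightarrow> measure \<nu> C < measure \<mu> C + e"
    using weak_star_upper_neighbourhood[OF \<mu> sets(1) \<open>e > 0\<close>] by (auto simp: closure[OF C])
  obtain V where V: "openin weak_star_topology V" "\<mu> \<in> V" "\<And>\<nu>. \<nu> \<in> V \<Longrightarrow> measure \<nu> (- C) < measure \<mu> (- C) + e"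
    using weak_star_upper_neighbourhood[OF \<mu> sets(2) \<open>e > 0\<close>] by (auto simp: closure[OF C'])
  have compl: "measure \<nu> (- C) = 1 - measure \<nu> C" if "\<nu> \<in> borel_prob_measures" for \<nu>
  proof -
    interpret prob_space \<nu> using that by (simp add: borel_prob_measures_def)
    have s: "sets \<nu> = sets borel" using that by (simp add: borel_prob_measures_def)
    show ?thesis using prob_compl[of C] sets s sets_eq_imp_space_eq[OF s] by (simp add: Compl_eq_Diff_UNIV)
  qed
  have "\<bar>measure \<mu> C - measure \<nu> C\<bar> < e" if "\<nu> \<in> U \<inter> V" for \<nu>
  proof -
    have "\<nu> \<in> borel_prob_measures"
      using that openin_subset[OF U(1)] by (auto simp: topspace_weak_star_topology)
    then show ?thesis
      using U(3)[of \<nu>] V(3)[of \<nu>] that compl[OF \<mu>] compl[of \<nu>] by (auto simp: abs_less_iff)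
  qed
  then show ?thesis using U V by (intro exI[of _ "U \<inter> V"]) auto
qed

section \<open>Upper semi-continuity\<close>

lemma AP_subset:
  assumes "(\<Sum>\<phi>\<in>F \<rightarrow>\<^sub>E {1..k}. \<bar>measure \<mu> (\<Inter>f\<in>F. act f -` A (\<phi> f)) - measure \<nu> (\<Inter>f\<in>F. act f -` A (\<phi> f))\<bar>) \<le> \<delta>"
  shows "AP act \<nu> n s k A F \<epsilon> \<subseteq> AP act \<mu> n s k A F (\<epsilon> + \<delta>)"
proof -
  have "partition_dist act \<mu> n s k A F B \<le> partition_dist act \<nu> n s k A F B + \<delta>" for B
  proof -
    have "partition_dist act \<mu> n s k A F B \<le> partition_dist act \<nu> n s k A F B +
      (\<Sum>\<phi>\<in>F \<rightarrow>\<^sub>E {1..k}. \<bar>measure \<mu> (\<Inter>f\<in>F. act f -` A (\<phi> f)) - measure \<nu> (\<Inter>f\<in>F. act f -` A (\<phi> f))\<bar>)"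
      unfolding partition_dist_def sum.distrib[symmetric] by (intro sum_mono) linarith
    then show ?thesis using assms by linarith
  qed
  then show ?thesis unfolding AP_def by (fastforce intro: order_trans)
qed

text \<open>A single window and tolerance witness the inequality for \<open>\<mu>\<close>. It
  involves the measures of finitely many continuity sets, and once these are almost the same for
  \<open>\<nu>\<close>, tolerance \<open>\<epsilon> / 2\<close> for \<open>\<nu>\<close> implies
  tolerance \<open>\<epsilon>\<close> for \<open>\<mu>\<close>.\<close>

lemma partition_entropy_eventually_less:
  fixes act :: "'g \<Rightarrow> 'x::metric_space \<Rightarrow> 'x"
  assumes "invariant_measure G act \<mu>" and cont: "\<And>j. j \<in> {1..k} \<Longrightarrow> continuity_set \<mu> (A j)"
    and less: "partition_entropy G act d \<sigma> \<mu> k A < c"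
  shows "\<exists>U. openin weak_star_topology U \<and> \<mu> \<in> U \<and> (\<forall>\<nu>\<in>U. partition_entropy G act d \<sigma> \<nu> k A < c)"
proof -
  interpret invariant_measure G act \<mu> by fact
  have \<mu>: "\<mu> \<in> borel_prob_measures" using invariant by (simp add: invariant_measures_def)
  obtain F \<epsilon> where F: "finite F" "F \<noteq> {}" "F \<subseteq> carrier G" and "\<epsilon> > 0"
    and less: "entropy_at act d \<sigma> \<mu> k A F \<epsilon> < c"
    using less by (auto simp: partition_entropy_def INF_less_iff)
  let ?S = "F \<rightarrow>\<^sub>E {1..k}"
  let ?C = "\<lambda>\<phi>. \<Inter>f\<in>F. act f -` A (\<phi> f)"
  have finS: "finite ?S" using F by (simp add: finite_PiE)
  define e where "e = \<epsilon> / (2 * (card ?S + 1))"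
  have "e > 0" using \<open>\<epsilon> > 0\<close> by (simp add: e_def)
  have "\<forall>\<phi>\<in>?S. \<exists>U. openin weak_star_topology U \<and> \<mu> \<in> U \<and> (\<forall>\<nu>\<in>U. \<bar>measure \<mu> (?C \<phi>) - measure \<nu> (?C \<phi>)\<bar> < e)"
  proof
    fix \<phi> assume "\<phi> \<in> ?S"
    then have "continuity_set \<mu> (?C \<phi>)"
      using F by (intro continuity_set_finite_Inter continuity_set_act_vimage cont)
        (auto simp: sets_eq finite_measure_axioms dest: PiE_mem)
    then show "\<exists>U. openin weak_star_topology U \<and> \<mu> \<in> U \<and> (\<forall>\<nu>\<in>U. \<bar>measure \<mu> (?C \<phi>) - measure \<nu> (?C \<phi>)\<bar> < e)"
      using \<open>e > 0\<close> by (rule weak_star_continuity_neighbourhood[OF \<mu>])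
  qed
  from bchoice[OF this] obtain U where "\<forall>\<phi>\<in>?S. openin weak_star_topology (U \<phi>) \<and> \<mu> \<in> U \<phi> \<and>
      (\<forall>\<nu>\<in>U \<phi>. \<bar>measure \<mu> (?C \<phi>) - measure \<nu> (?C \<phi>)\<bar> < e)" ..
  then have U: "openin weak_star_topology (U \<phi>)" "\<mu> \<in> U \<phi>"
    "\<And>\<nu>. \<nu> \<in> U \<phi> \<Longrightarrow> \<bar>measure \<mu> (?C \<phi>) - measure \<nu> (?C \<phi>)\<bar> < e" if "\<phi> \<in> ?S" for \<phi>
    using that by (simp_all add: Ball_def)
  \<comment> \<open>The intersection with the whole space keeps this an open set even when
    \<open>?S\<close> is empty.\<close>
  let ?V = "(\<Inter>\<phi>\<in>?S. U \<phi>) \<inter> topspace weak_star_topology"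
  have "openin weak_star_topology ?V"
    using finS U by (intro openin_INT) auto
  moreover have "\<mu> \<in> ?V" using U \<mu> by (auto simp: topspace_weak_star_topology)
  moreover have "partition_entropy G act d \<sigma> \<nu> k A < c" if \<nu>: "\<nu> \<in> ?V" for \<nu>
  proof -
    have "(\<Sum>\<phi>\<in>?S. \<bar>measure \<mu> (?C \<phi>) - measure \<nu> (?C \<phi>)\<bar>) \<le> (\<Sum>\<phi>\<in>?S. e)"
      using \<nu> U by (intro sum_mono) (auto intro: less_imp_le)
    also have "\<dots> \<le> \<epsilon> / 2"
      using \<open>\<epsilon> > 0\<close> by (simp add: e_def field_simps)
    finally have "AP act \<nu> n s k A F (\<epsilon> / 2) \<subseteq> AP act \<mu> n s k A F \<epsilon>" for n s
      using AP_subset[where F=F and k=k and \<mu>=\<mu> and act=act and A=A and \<nu>=\<nu> and \<delta>="\<epsilon> / 2" and \<epsilon>="\<epsilon> / 2"] by simp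
    moreover have "finite (AP act \<mu> n s k A F \<epsilon>)" for n s
      by (rule finite_subset[OF _ finite_indexed_partitions]) (auto simp: AP_def)
    ultimately have "entropy_at act d \<sigma> \<nu> k A F (\<epsilon> / 2) \<le> entropy_at act d \<sigma> \<mu> k A F \<epsilon>"
      unfolding entropy_at_def
      by (intro Limsup_mono always_eventually allI ereal_mult_left_mono log_card_mono) auto
    moreover have "partition_entropy G act d \<sigma> \<nu> k A \<le> entropy_at act d \<sigma> \<nu> k A F (\<epsilon> / 2)"
      unfolding partition_entropy_def using F \<open>\<epsilon> > 0\<close>
      by (intro INF_lower2[of F] INF_lower2[of "\<epsilon> / 2"]) auto
    ultimately show ?thesis using less by (meson le_less_trans)
  qed
  ultimately show ?thesis by blast
qed

theorem theorem2p1: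
  fixes G :: "('g, 'm) monoid_scheme"
    and act :: "'g \<Rightarrow> 'x::metric_space \<Rightarrow> 'x"
    and d :: "nat \<Rightarrow> nat"
    and \<sigma> :: "nat \<Rightarrow> 'g \<Rightarrow> nat \<Rightarrow> nat"
  assumes "group G" and "countable (carrier G)"
    and "sofic_approximation G d \<sigma>"
    and "compact (UNIV :: 'x set)"
    and "continuous_action G act"
    and "expansive G act"
    and "invariant_measures G act \<noteq> {}"
  shows "sofic_entropy G act d \<sigma> \<in> invariant_measures G act \<rightarrow> {0..<\<infinity>} \<union> {- \<infinity>} \<and>
    upper_semicontinuous_map (subtopology weak_star_topology (invariant_measures G act))
      (sofic_entropy G act d \<sigma>)"
proof -
  let ?h = "sofic_entropy G act d \<sigma>" and ?M = "invariant_measures G act"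
  note sofic = assms(3) and compact = assms(4)
  have inv: "invariant_measure G act \<mu>" if "\<mu> \<in> ?M" for \<mu>
    using assms(1,5) that by (rule invariant_measure.intro)
  obtain \<delta> where "\<delta> > 0" and \<delta>: "\<And>x y. x \<noteq> y \<Longrightarrow> \<exists>g\<in>carrier G. dist (act g x) (act g y) > \<delta>"
    using assms(6) by (auto simp: expansive_def)
  \<comment> \<open>The partition has null boundaries only with respect to \<open>\<mu>\<close>, but
    by expansiveness it generates for every invariant \<open>\<nu>\<close>. One formula therefore
    computes the entropy at \<open>\<mu>\<close> and at all measures near it.\<close>
  have key: "\<exists>k A. borel_partition k A \<and> (\<forall>j\<in>{1..k}. continuity_set \<mu> (A j)) \<and>
      (\<forall>\<nu>\<in>?M. ?h \<nu> = partition_entropy G act d \<sigma> \<nu> k A)" if \<mu>: "\<mu> \<in> ?M" for \<mu>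
  proof -
    interpret invariant_measure G act \<mu> by (rule inv[OF \<mu>])
    obtain k A where A: "borel_partition k A"
      "\<And>j. j \<in> {1..k} \<Longrightarrow> continuity_set \<mu> (A j)"
      "\<And>j x y. j \<in> {1..k} \<Longrightarrow> x \<in> A j \<Longrightarrow> y \<in> A j \<Longrightarrow> dist x y \<le> \<delta>"
      using exists_continuity_partition[OF finite_measure_axioms sets_eq compact \<open>\<delta> > 0\<close>] by blast
    have "?h \<nu> = partition_entropy G act d \<sigma> \<nu> k A" if \<nu>: "\<nu> \<in> ?M" for \<nu>
    proof (rule invariant_measure.sofic_entropy_eq[OF inv[OF \<nu>] sofic A(1)])
      show "generating G act \<nu> k A"
        by (rule expansive_generating[where \<delta>=\<delta>, OF inv[OF \<nu>] compact _ A(1)]) (fact \<delta>, fact A(3))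
    qed
    then show ?thesis using A by blast
  qed
  have range: "?h \<mu> \<in> {0..<\<infinity>} \<union> {- \<infinity>}" if \<mu>: "\<mu> \<in> ?M" for \<mu>
    using key[OF \<mu>] invariant_measure.partition_entropy_range[OF inv[OF \<mu>] sofic] \<mu> by metis
  have "Limsup (atin (subtopology weak_star_topology ?M) \<mu>) ?h \<le> ?h \<mu>" if \<mu>: "\<mu> \<in> ?M" for \<mu>
    \<comment> \<open>It suffices that every \<open>c\<close> above the value at
      \<open>\<mu>\<close> is eventually a strict upper bound.\<close>
    unfolding Limsup_le_iff
  proof (intro allI impI)
    fix c assume "?h \<mu> < c"
    obtain k A where "borel_partition k A" and A: "\<And>j. j \<in> {1..k} \<Longrightarrow> continuity_set \<mu> (A j)"
      and h: "\<And>\<nu>. \<nu> \<in> ?M \<Longrightarrow> ?h \<nu> = partition_entropy G act d \<sigma> \<nu> k A"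
      using key[OF \<mu>] by blast
    have "partition_entropy G act d \<sigma> \<mu> k A < c" using \<open>?h \<mu> < c\<close> h[OF \<mu>] by simp
    from partition_entropy_eventually_less[OF inv[OF \<mu>] A this]
    obtain U where U: "openin weak_star_topology U" "\<mu> \<in> U"
      "\<And>\<nu>. \<nu> \<in> U \<Longrightarrow> partition_entropy G act d \<sigma> \<nu> k A < c"
      by blast
    have "openin (subtopology weak_star_topology ?M) (U \<inter> ?M)"
      using U(1) by (auto simp: openin_subtopology)
    moreover have "?h \<nu> < c" if "\<nu> \<in> U \<inter> ?M" for \<nu>
      using U(3) h that by simp
    ultimately show "\<forall>\<^sub>F \<nu> in atin (subtopology weak_star_topology ?M) \<mu>. ?h \<nu> < c"
      unfolding eventually_atin using U(2) \<mu> by (intro disjI2 exI[of _ "U \<inter> ?M"]) simp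
  qed
  moreover have "?h \<mu> \<noteq> \<infinity>" if "\<mu> \<in> ?M" for \<mu>
    using range[OF that] by auto
  ultimately show ?thesis
    using range unfolding upper_semicontinuous_map_def by auto
qed

end
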